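(* When the Baire space $\mathcal{N}$ is equipped with the product metric, the universal minimal flow of $\mathrm{iso}(\mathcal{N})$ is the set $\mathrm{cLO}(\mathcal{N})$ of all convex linear orderings on $\mathcal{N}$, together with the action $\mathrm{iso}(\mathcal{N})\times\mathrm{cLO}(\mathcal{N})\longrightarrow\mathrm{cLO}(\mathcal{N})$, $(g,<)\longmapsto\,<^g$, defined by $$x<^g y\quad\text{iff}\quad g^{-1}(x)<g^{-1}(y).$$
   Context: $\mathcal{N}$ is the Baire space, i.e. the set of all sequences $x:\omega\to\omega$, with the ultrametric $d(x,y)=1/(n+1)$ where $n$ is the least integer with $x(n)\neq y(n)$ (for $x\neq y$). $\mathrm{iso}(\mathcal{N})$ is the group of isometries of $\mathcal{N}$ onto itself with the topology of pointwise convergence relative to the metric topology on $\mathcal{N}$. A linear ordering on $\mathcal{N}$ is convex when all metric balls of $\mathcal{N}$ are convex for it. $\mathrm{cLO}(\mathcal{N})$ carries the compact topology whose basic open sets are $\{\prec\,\in\mathrm{cLO}(\mathcal{N}):\prec\restriction F=\,<\restriction F\}$ for $F\subset\mathcal{N}$ finite and $<\,\in\mathrm{cLO}(\mathcal{N})$. For a topological group $G$, a $G$-flow is a continuous action of $G$ on a (nonempty) compact Hausdorff space; it is minimal when every orbit is dense. A homomorphism of $G$-flows is a continuous $G$-equivariant map. The universal minimal flow of $G$ is the minimal $G$-flow, unique up to isomorphism, which admits a surjective homomorphism onto every minimal $G$-flow. *)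

theory Defs
  imports "HOL-Algebra.Group_Action" "HOL-Analysis.Analysis"
begin

section \<open>Flows of topological groups\<close>

locale topological_group = group G for G (structure) +
  fixes T
  assumes topspace_group: "topspace T = carrier G"
    and continuous_mult: "continuous_map (prod_topology T T) T (\<lambda>(x, y). x \<otimes> y)"
    and continuous_inverse: "continuous_map T T (\<lambda>x. inv x)"

text \<open>
  The library locale \<open>group_action\<close> requires each \<open>\<phi> g\<close> to be extensional, that is, to take the
  value \<open>undefined\<close> outside the space acted on. This only normalises irrelevant values.
\<close>

locale flow = topological_group G T + group_action G "topspace X" \<phi>
  for G (structure) and T and X :: "'x topology" and \<phi> +
  assumes nonempty: "topspace X \<noteq> {}"
    and compact: "compact_space X"
    and Hausdorff: "Hausdorff_space X"
    and continuous_action: "continuous_map (prod_topology T X) X (\<lambda>(g, x). \<phi> g x)"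

locale minimal_flow = flow +
  assumes dense_orbit: "x \<in> topspace X \<Longrightarrow> X closure_of (orbit G \<phi> x) = topspace X"

definition flow_hom ::
    "('g, 'm) monoid_scheme \<Rightarrow> 'x topology \<Rightarrow> ('g \<Rightarrow> 'x \<Rightarrow> 'x)
      \<Rightarrow> 'y topology \<Rightarrow> ('g \<Rightarrow> 'y \<Rightarrow> 'y) \<Rightarrow> ('x \<Rightarrow> 'y) \<Rightarrow> bool" where
  "flow_hom G X \<phi> Y \<psi> f \<longleftrightarrow>
     continuous_map X Y f \<and>
     (\<forall>g\<in>carrier G. \<forall>x\<in>topspace X. f (\<phi> g x) = \<psi> g (f x))"

text \<open>
  HOL cannot quantify over types inside a formula, so the type of points of the competing minimal
  flows is a parameter of the definition. In a theorem, a free type variable \<open>'y\<close> at this place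
  ranges over all types, hence the competitors range over all minimal flows.
\<close>

definition universal_minimal_flow ::
    "'y itself \<Rightarrow> ('g, 'm) monoid_scheme \<Rightarrow> 'g topology
      \<Rightarrow> 'x topology \<Rightarrow> ('g \<Rightarrow> 'x \<Rightarrow> 'x) \<Rightarrow> bool" where
  "universal_minimal_flow _ G T X \<phi> \<longleftrightarrow>
     minimal_flow G T X \<phi> \<and>
     (\<forall>(Y :: 'y topology) \<psi>. minimal_flow G T Y \<psi> \<longrightarrow>
        (\<exists>f. flow_hom G X \<phi> Y \<psi> f \<and> f ` topspace X = topspace Y))"


section \<open>The Baire space and its isometry group\<close>

type_synonym baire = "nat \<Rightarrow> nat"

definition baire_dist :: "baire \<Rightarrow> baire \<Rightarrow> real" where
  "baire_dist x y = (if x = y then 0 else 1 / (real (LEAST n. x n \<noteq> y n) + 1))"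

lemma baire_dist_ultra: "baire_dist x z \<le> max (baire_dist x y) (baire_dist y z)"
proof (cases "x = y \<or> y = z \<or> x = z")
  case True
  then show ?thesis by (auto simp: baire_dist_def le_max_iff_disj)
next
  case False
  define n where "n = (LEAST n. x n \<noteq> z n)"
  have "\<exists>n. x n \<noteq> z n"
    using False by auto
  then have "x n \<noteq> z n"
    unfolding n_def by (rule LeastI_ex)
  then consider "x n \<noteq> y n" | "y n \<noteq> z n" by metis
  then show ?thesis
  proof cases
    case 1
    then have "(LEAST n. x n \<noteq> y n) \<le> n" by (rule Least_le)
    then have "baire_dist x z \<le> baire_dist x y"
      using False by (simp add: baire_dist_def n_def [symmetric] frac_le)
    then show ?thesis by simp
  next
    case 2
    then have "(LEAST n. y n \<noteq> z n) \<le> n" by (rule Least_le)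
    then have "baire_dist x z \<le> baire_dist y z"
      using False by (simp add: baire_dist_def n_def [symmetric] frac_le)
    then show ?thesis by simp
  qed
qed

interpretation baire: Metric_space UNIV baire_dist
proof
  fix x y z :: baire
  show nonneg: "0 \<le> baire_dist x y" for x y by (simp add: baire_dist_def)
  show "baire_dist x y = baire_dist y x" by (simp add: baire_dist_def eq_commute)
  show "baire_dist x y = 0 \<longleftrightarrow> x = y" by (simp add: baire_dist_def add_nonneg_eq_0_iff)
  show "baire_dist x z \<le> baire_dist x y + baire_dist y z"
    using baire_dist_ultra [of x z y] nonneg [of x y] nonneg [of y z] by linarith
qed

definition iso_baire :: "(baire \<Rightarrow> baire) monoid" where
  "iso_baire =
     \<lparr>carrier = {g. bij g \<and> (\<forall>x y. baire_dist (g x) (g y) = baire_dist x y)},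
      monoid.mult = (\<circ>), one = id\<rparr>"

definition iso_baire_topology :: "(baire \<Rightarrow> baire) topology" where
  "iso_baire_topology =
     subtopology (product_topology (\<lambda>_. baire.mtopology) UNIV) (carrier iso_baire)"


section \<open>Convex linear orderings\<close>

definition order_convex :: "'a rel \<Rightarrow> 'a set \<Rightarrow> bool" where
  "order_convex r B \<longleftrightarrow> (\<forall>x\<in>B. \<forall>z\<in>B. \<forall>y. (x, y) \<in> r \<and> (y, z) \<in> r \<longrightarrow> y \<in> B)"

text \<open>Orderings are strict: \<open>(x, y) \<in> r\<close> stands for \<open>x < y\<close>.\<close>

definition cLO :: "baire rel set" where
  "cLO = {r. strict_linear_order r \<and>
             (\<forall>x e. order_convex r (baire.mball x e) \<and> order_convex r (baire.mcball x e))}"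

definition cLO_topology :: "baire rel topology" where
  "cLO_topology =
     topology_generated_by {{s \<in> cLO. Restr s F = Restr r F} | F r. finite F \<and> r \<in> cLO}"

definition cLO_action :: "(baire \<Rightarrow> baire) \<Rightarrow> baire rel \<Rightarrow> baire rel" where
  "cLO_action g = (\<lambda>r\<in>cLO. {(x, y). (inv_into UNIV g x, inv_into UNIV g y) \<in> r})"

lemma topspace_cLO_topology [simp]: "topspace cLO_topology = cLO"
  unfolding cLO_topology_def topology_generated_by_topspace by blast

end

theory Submission
  imports Defs "HOL-Library.Ramsey"
begin

text \<open>
  An isometry of the Baire space is an automorphism of the tree of finite sequences, and a convex
  linear ordering is an arbitrary choice of a linear ordering of the successors of each node.

  The flow of convex orderings is compact, because convex orderings form a closed set of relations,
  and it is minimal, because the finitely many branches that a finite set of points has at a node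
  can be permuted into any order (\<open>realize_finite_order\<close>, \<open>dense_orbit_cLO\<close>).

  For universality, consider the ordering \<open>lex_order\<close>, which orders the successors of every node
  like the rationals. In any flow \<open>Y\<close> there is a point \<open>y\<close> fixed by every automorphism of the
  rationals placed at any single node. For one node this is the extreme amenability of the
  automorphism group of the rationals, a consequence of Ramsey's theorem (\<open>rat_aut_ramsey\<close>,
  \<open>node_fixed_point\<close>). For all nodes it follows by compactness, because permutations at different
  nodes of one level commute, and permutations at higher nodes normalise those of a deeper level
  (\<open>nodes_fixed_point\<close>).

  By homogeneity of the rationals, every isometry that preserves \<open>lex_order\<close> on a finite set is
  approximated there by products of such automorphisms (\<open>lex_order_homogeneous\<close>). Therefore the
  map \<open>g \<cdot> lex_order \<mapsto> g \<cdot> y\<close> is well defined and extends continuously: the closure of its graph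
  is again a graph (\<open>graph_closure_functional\<close>), and it is defined everywhere since the orbit of
  \<open>lex_order\<close> is dense. Its image is closed and contains the orbit of \<open>y\<close>, so it is all of \<open>Y\<close>
  when \<open>Y\<close> is minimal.
\<close>


section \<open>Order automorphisms of the rationals and Ramsey's theorem\<close>

lemma finite_has_last:
  assumes "strict_linear_order r" "finite C" "C \<noteq> {}"
  obtains c where "c \<in> C" "\<And>a. a \<in> C \<Longrightarrow> a \<noteq> c \<Longrightarrow> (a, c) \<in> r"
proof -
  have "\<exists>c\<in>C. \<forall>a\<in>C. a \<noteq> c \<longrightarrow> (a, c) \<in> r"
    using assms(2,3)
  proof (induction C rule: finite_ne_induct)
    case (insert x F)
    then obtain c where c: "c \<in> F" "\<forall>a\<in>F. a \<noteq> c \<longrightarrow> (a, c) \<in> r" by blast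
    have "x \<noteq> c" using c insert by blast
    then consider "(x, c) \<in> r" | "(c, x) \<in> r"
      using assms(1) by (auto simp: strict_linear_order_on_def total_on_def)
    then show ?case
    proof cases
      case 1 then show ?thesis using c by blast
    next
      case 2
      then have "\<forall>a\<in>F. (a, x) \<in> r"
        using c assms(1) unfolding strict_linear_order_on_def by (metis transD)
      then show ?thesis by blast
    qed
  qed simp
  then show thesis using that by blast
qed

lemma strict_linear_orderD:
  assumes "strict_linear_order r"
  shows "(x, x) \<notin> r"
    and "(x, y) \<in> r \<Longrightarrow> (y, z) \<in> r \<Longrightarrow> (x, z) \<in> r"
    and "(x, y) \<in> r \<Longrightarrow> (y, x) \<notin> r"
    and "x \<noteq> y \<Longrightarrow> (x, y) \<notin> r \<Longrightarrow> (y, x) \<in> r"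
  using assms unfolding strict_linear_order_on_def irrefl_def total_on_def
  by (blast dest: transD)+

lemma strict_linear_order_inv_image:
  assumes "strict_linear_order r" "inj f"
  shows "strict_linear_order (inv_image r f)"
proof -
  have "trans (inv_image r f)"
    using strict_linear_orderD(2) [OF assms(1)] by (auto intro!: transI)
  moreover have "irrefl (inv_image r f)"
    using strict_linear_orderD(1) [OF assms(1)] by (auto intro!: irreflI)
  moreover have "total (inv_image r f)"
    using strict_linear_orderD(4) [OF assms(1)] injD [OF assms(2)]
    by (auto simp: total_on_def)
  ultimately show ?thesis
    by (simp add: strict_linear_order_on_def)
qed

text \<open>By induction on the size: the isomorphism must match the last elements.\<close>

lemma finite_orders_isomorphic:
  fixes r :: "'a rel" and s :: "'b rel"
  assumes r: "strict_linear_order r" and s: "strict_linear_order s"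
    and "finite C" "finite D" "card C = card D"
  obtains f where "bij_betw f C D"
    and "\<And>a b. a \<in> C \<Longrightarrow> b \<in> C \<Longrightarrow> (f a, f b) \<in> s \<longleftrightarrow> (a, b) \<in> r"
proof -
  have "\<exists>f. bij_betw f C D \<and> (\<forall>a\<in>C. \<forall>b\<in>C. (f a, f b) \<in> s \<longleftrightarrow> (a, b) \<in> r)"
    using assms(3-)
  proof (induction "card C" arbitrary: C D)
    case 0
    then show ?case by (auto simp: bij_betw_def)
  next
    case (Suc n)
    have "C \<noteq> {}" "D \<noteq> {}" using Suc.hyps Suc.prems by auto
    obtain c where c: "c \<in> C" "\<And>a. a \<in> C \<Longrightarrow> a \<noteq> c \<Longrightarrow> (a, c) \<in> r"
      using finite_has_last [OF r \<open>finite C\<close> \<open>C \<noteq> {}\<close>] by blast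
    obtain d where d: "d \<in> D" "\<And>a. a \<in> D \<Longrightarrow> a \<noteq> d \<Longrightarrow> (a, d) \<in> s"
      using finite_has_last [OF s \<open>finite D\<close> \<open>D \<noteq> {}\<close>] by blast
    have "\<exists>f. bij_betw f (C - {c}) (D - {d}) \<and>
            (\<forall>a\<in>C - {c}. \<forall>b\<in>C - {c}. (f a, f b) \<in> s \<longleftrightarrow> (a, b) \<in> r)"
      using Suc.prems Suc.hyps c d by (intro Suc.hyps(1)) auto
    then obtain f where f: "bij_betw f (C - {c}) (D - {d})"
      "\<And>a b. a \<in> C - {c} \<Longrightarrow> b \<in> C - {c} \<Longrightarrow> (f a, f b) \<in> s \<longleftrightarrow> (a, b) \<in> r" by blast
    have fD: "f a \<in> D - {d}" if "a \<in> C - {c}" for a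
      using f(1) that by (rule bij_betwE [rule_format])
    let ?f = "f(c := d)"
    have "bij_betw ?f (C - {c}) (D - {d})"
      by (rule bij_betw_cong [THEN iffD1, OF _ f(1)]) auto
    then have "bij_betw ?f (insert c (C - {c})) (insert (?f c) (D - {d}))"
      by (subst notIn_Un_bij_betw3 [symmetric, simplified, of c "C - {c}" ?f "D - {d}"]) auto
    then have "bij_betw ?f C D"
      using c(1) d(1) by (simp add: insert_absorb)
    moreover have "(?f a, ?f b) \<in> s \<longleftrightarrow> (a, b) \<in> r" if "a \<in> C" "b \<in> C" for a b
    proof -
      consider "a = c" "b = c" | "a = c" "b \<noteq> c" | "a \<noteq> c" "b = c" | "a \<noteq> c" "b \<noteq> c" by blast
      then show ?thesis
      proof cases
        case 1
        then show ?thesis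
          using strict_linear_orderD(1) [OF r] strict_linear_orderD(1) [OF s] by simp
      next
        case 2
        then show ?thesis
          using c(2) [of b] d(2) [of "f b"] fD [of b] that
            strict_linear_orderD(3) [OF r] strict_linear_orderD(3) [OF s] by auto
      next
        case 3
        then show ?thesis using c(2) [of a] d(2) [of "f a"] fD [of a] that by auto
      next
        case 4
        then show ?thesis using f(2) that by auto
      qed
    qed
    ultimately show ?case by blast
  qed
  then show thesis using that by blast
qed

lemma permutation_between_orders:
  fixes r s :: "'a rel"
  assumes r: "strict_linear_order r" and s: "strict_linear_order s" and "finite C"
  obtains p where "bij p" "\<And>a b. a \<in> C \<Longrightarrow> b \<in> C \<Longrightarrow> (p a, p b) \<in> s \<longleftrightarrow> (a, b) \<in> r"
proof -
  obtain f where f: "bij_betw f C C"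
    "\<And>a b. a \<in> C \<Longrightarrow> b \<in> C \<Longrightarrow> (f a, f b) \<in> s \<longleftrightarrow> (a, b) \<in> r"
    using finite_orders_isomorphic [OF r s \<open>finite C\<close> \<open>finite C\<close>] by auto
  define p where "p a = (if a \<in> C then f a else a)" for a
  have "bij_betw p C C"
    using f(1) by (rule bij_betw_cong [THEN iffD1, rotated]) (simp add: p_def)
  moreover have "bij_betw p (- C) (- C)"
    by (rule bij_betw_cong [THEN iffD1, rotated, OF bij_betw_id]) (simp add: p_def)
  ultimately have "bij_betw p (C \<union> - C) (C \<union> - C)"
    by (rule bij_betw_combine) simp
  then show thesis using that [of p] f(2) by (simp add: p_def)
qed

text \<open>
  The alphabet of the Baire space is ordered like the rationals, the only homogeneous countable
  linear ordering with more than one point.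
\<close>

definition rat_label :: "nat \<Rightarrow> rat" where
  "rat_label = from_nat_into UNIV"

lemma bij_rat_label: "bij rat_label"
  unfolding rat_label_def
  by (rule bij_betw_from_nat_into) (auto simp: infinite_UNIV_char_0)

definition rat_less :: "nat rel" where
  "rat_less = {(a, b). rat_label a < rat_label b}"

lemma strict_linear_order_rat_less: "strict_linear_order rat_less"
proof -
  have "rat_label a \<noteq> rat_label b" if "a \<noteq> b" for a b
    using that bij_rat_label by (auto dest: bij_is_inj injD)
  then show ?thesis
    by (auto simp: strict_linear_order_on_def rat_less_def trans_def irrefl_def total_on_def
        dest: linorder_neqE)
qed

definition rat_aut :: "(nat \<Rightarrow> nat) set" where
  "rat_aut = {p. bij p \<and> (\<forall>a b. (p a, p b) \<in> rat_less \<longleftrightarrow> (a, b) \<in> rat_less)}"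

lemma rat_aut_bij: "p \<in> rat_aut \<Longrightarrow> bij p"
  by (simp add: rat_aut_def)

lemma rat_aut_less: "p \<in> rat_aut \<Longrightarrow> (p a, p b) \<in> rat_less \<longleftrightarrow> (a, b) \<in> rat_less"
  by (simp add: rat_aut_def)

lemma id_rat_aut: "id \<in> rat_aut"
  by (simp add: rat_aut_def)

lemma comp_rat_aut: "p \<in> rat_aut \<Longrightarrow> q \<in> rat_aut \<Longrightarrow> p \<circ> q \<in> rat_aut"
  by (simp add: rat_aut_def bij_comp)

lemma inv_rat_aut: "p \<in> rat_aut \<Longrightarrow> inv_into UNIV p \<in> rat_aut"
  unfolding rat_aut_def by (simp add: bij_imp_bij_inv) (metis bij_inv_eq_iff)

text \<open>
  The rationals are homogeneous: an automorphism moves the smaller points of the finite set to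
  their targets, and stretching the half-line to the right of the last target then corrects the
  image of the largest point without disturbing the others.
\<close>

lemma rat_homogeneous:
  fixes f :: "rat \<Rightarrow> rat"
  assumes "finite C" and "\<And>x y. x \<in> C \<Longrightarrow> y \<in> C \<Longrightarrow> x < y \<Longrightarrow> f x < f y"
  shows "\<exists>p. bij p \<and> strict_mono p \<and> (\<forall>x\<in>C. p x = f x)"
  using assms
proof (induction C rule: finite_linorder_max_induct)
  case empty
  then show ?case by (intro exI [of _ "\<lambda>x. x"]) (auto simp: strict_mono_def bij_id [unfolded id_def])
next
  case (insert b A)
  then obtain p where p: "bij p" "strict_mono p" "\<And>x. x \<in> A \<Longrightarrow> p x = f x" by auto
  show ?case
  proof (cases "A = {}")
    case True
    have "bij (\<lambda>x. x + (f b - b))"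
      by (rule bij_betw_byWitness [where f' = "\<lambda>x. x - (f b - b)"]) auto
    then show ?thesis
      using True by (intro exI [of _ "\<lambda>x. x + (f b - b)"]) (simp add: strict_mono_def)
  next
    case False
    define m where "m = Max A"
    have m: "m \<in> A" "\<And>x. x \<in> A \<Longrightarrow> x \<le> m" using False insert.hyps by (auto simp: m_def)
    define e where "e = f m"
    have "m < b" using m insert.hyps by blast
    then have e: "e < p b" "e < f b"
      using p m insert.prems by (auto simp: e_def strict_mono_def dest: p(3) [symmetric])
    define c where "c = (f b - e) / (p b - e)"
    have c: "c > 0" using e by (simp add: c_def)
    define q where "q x = (if x \<le> e then x else e + (x - e) * c)" for x
    define q' where "q' x = (if x \<le> e then x else e + (x - e) / c)" for x
    have "bij q"
      by (rule bij_betw_byWitness [where f' = q'])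
        (use c in \<open>auto simp: q_def q'_def zero_less_mult_iff mult_le_0_iff divide_le_0_iff\<close>)
    moreover have "strict_mono q"
      unfolding strict_mono_def q_def using c
      by (auto simp: not_le intro: less_le_trans le_less_trans)
    ultimately have "bij (q \<circ> p)" "strict_mono (q \<circ> p)"
      using p by (auto simp: bij_comp strict_mono_def)
    moreover have "(q \<circ> p) x = f x" if "x \<in> insert b A" for x
    proof (cases "x = b")
      case True
      then show ?thesis using e by (simp add: q_def c_def)
    next
      case False
      then have x: "x \<in> A" using that by simp
      then have "p x \<le> e" using p m unfolding e_def
        by (metis strict_mono_less_eq)
      then show ?thesis using p x by (simp add: q_def)
    qed
    ultimately show ?thesis by blast
  qed
qed

lemma rat_aut_extend:
  assumes "finite C"
    and "\<And>a b. a \<in> C \<Longrightarrow> b \<in> C \<Longrightarrow> (a, b) \<in> rat_less \<Longrightarrow> (f a, f b) \<in> rat_less"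
  obtains p where "p \<in> rat_aut" "\<And>a. a \<in> C \<Longrightarrow> p a = f a"
proof -
  note l = bij_rat_label
  have inv1: "inv_into UNIV rat_label (rat_label a) = a" for a by (simp add: l bij_is_inj)
  have inv2: "rat_label (inv_into UNIV rat_label x) = x" for x by (simp add: l bij_is_surj surj_f_inv_f)
  have "\<exists>p. bij p \<and> strict_mono p \<and>
      (\<forall>x\<in>rat_label ` C. p x = (rat_label \<circ> f \<circ> inv_into UNIV rat_label) x)"
    by (rule rat_homogeneous) (use assms in \<open>auto simp: inv1 rat_less_def\<close>)
  then obtain p where p: "bij p" "strict_mono p"
    "\<And>a. a \<in> C \<Longrightarrow> p (rat_label a) = rat_label (f a)" by (auto simp: inv1)
  let ?p = "inv_into UNIV rat_label \<circ> p \<circ> rat_label"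
  have "?p \<in> rat_aut"
    using p l by (simp add: rat_aut_def bij_comp bij_imp_bij_inv rat_less_def inv2 strict_mono_less)
  then show thesis using that p(3) by (simp add: inv1)
qed

text \<open>
  An element of a finite set is determined by the number of its predecessors in the set, and
  automorphisms preserve this number.
\<close>

lemma rat_aut_determined_by_image:
  assumes p: "p \<in> rat_aut" and q: "q \<in> rat_aut" and "finite C" "p ` C = q ` C" "a \<in> C"
  shows "p a = q a"
proof (rule ccontr)
  assume ne: "p a \<noteq> q a"
  have card: "card {y \<in> p ` C. (y, p a) \<in> rat_less} = card {x \<in> C. (x, a) \<in> rat_less}"
    if "p \<in> rat_aut" for p
  proof -
    have "{y \<in> p ` C. (y, p a) \<in> rat_less} = p ` {x \<in> C. (x, a) \<in> rat_less}"
      using rat_aut_less [OF that] by auto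
    then show ?thesis
      using rat_aut_bij [OF that, THEN bij_is_inj] by (simp add: card_image inj_on_subset)
  qed
  let ?E = "p ` C"
  note lin = strict_linear_orderD [OF strict_linear_order_rat_less]
  have lt: "card {y \<in> ?E. (y, u) \<in> rat_less} < card {y \<in> ?E. (y, v) \<in> rat_less}"
    if "(u, v) \<in> rat_less" "u \<in> ?E" for u v
  proof (rule psubset_card_mono)
    show "finite {y \<in> ?E. (y, v) \<in> rat_less}" using assms by simp
    show "{y \<in> ?E. (y, u) \<in> rat_less} \<subset> {y \<in> ?E. (y, v) \<in> rat_less}"
    proof (rule psubsetI)
      show "{y \<in> ?E. (y, u) \<in> rat_less} \<subseteq> {y \<in> ?E. (y, v) \<in> rat_less}"
        using lin(2) [OF _ that(1)] by auto
      have "u \<in> {y \<in> ?E. (y, v) \<in> rat_less}" "u \<notin> {y \<in> ?E. (y, u) \<in> rat_less}"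
        using that lin(1) by auto
      then show "{y \<in> ?E. (y, u) \<in> rat_less} \<noteq> {y \<in> ?E. (y, v) \<in> rat_less}"
        by blast
    qed
  qed
  have "p a \<in> ?E" "q a \<in> ?E" using assms by auto
  then have "card {y \<in> ?E. (y, p a) \<in> rat_less} \<noteq> card {y \<in> ?E. (y, q a) \<in> rat_less}"
    using lt [of "p a" "q a"] lt [of "q a" "p a"] lin(4) [OF ne] by linarith
  then show False using card [OF p] card [OF q] assms(4) by simp
qed

text \<open>
  The pigeonhole principle from which all fixed points are produced. A colouring of automorphisms
  that only looks at their values on \<open>C\<close> is a colouring of the sets \<open>p ` C\<close>, since an order
  isomorphism of finite sets is determined by its range. Ramsey's theorem makes all sets of this
  size inside some infinite set have one colour, and homogeneity moves the finitely many sets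
  \<open>h ` C\<close> together into that infinite set.
\<close>

lemma rat_aut_ramsey:
  fixes c :: "(nat \<Rightarrow> nat) \<Rightarrow> 'c"
  assumes "finite C" and K: "finite K" "K \<subseteq> rat_aut" and P: "finite (c ` rat_aut)"
    and c: "\<And>p q. p \<in> rat_aut \<Longrightarrow> q \<in> rat_aut \<Longrightarrow> (\<And>a. a \<in> C \<Longrightarrow> p a = q a) \<Longrightarrow> c p = c q"
  obtains g where "g \<in> rat_aut" "\<And>h h'. h \<in> K \<Longrightarrow> h' \<in> K \<Longrightarrow> c (g \<circ> h) = c (g \<circ> h')"
proof -
  obtain idx :: "'c \<Rightarrow> nat" and n where idx: "idx ` (c ` rat_aut) = {i. i < n}" "inj_on idx (c ` rat_aut)"
    using finite_imp_inj_to_nat_seg [OF P] by blast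
  \<comment> \<open>The value at sets that are not images of \<open>C\<close> is arbitrary, but must be one of finitely many.\<close>
  define col where "col X =
    (if \<exists>p\<in>rat_aut. p ` C = X then idx (c (SOME p. p \<in> rat_aut \<and> p ` C = X)) else 0)" for X
  have col: "col (p ` C) = idx (c p)" if p: "p \<in> rat_aut" for p
  proof -
    let ?q = "SOME q. q \<in> rat_aut \<and> q ` C = p ` C"
    have "?q \<in> rat_aut \<and> ?q ` C = p ` C" by (rule someI [of _ p]) (simp add: p)
    then have "c ?q = c p"
      using p by (intro c rat_aut_determined_by_image [OF _ p \<open>finite C\<close>]) auto
    then show ?thesis using p by (auto simp: col_def)
  qed
  have "idx (c p) < n" if "p \<in> rat_aut" for p using idx(1) that by auto
  then have "col X < Suc n" for X
    using col by (cases "\<exists>p\<in>rat_aut. p ` C = X") (auto simp: less_Suc_eq, auto simp: col_def)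
  then obtain Y t where Y: "infinite Y"
    "\<And>X. X \<subseteq> Y \<Longrightarrow> finite X \<Longrightarrow> card X = card C \<Longrightarrow> col X = t"
    using Ramsey [of "UNIV :: nat set" "card C" col "Suc n"] by auto
  define D where "D = (\<Union>h\<in>K. h ` C)"
  have "finite D" using \<open>finite C\<close> K(1) by (simp add: D_def)
  obtain E where E: "E \<subseteq> Y" "finite E" "card E = card D"
    using infinite_arbitrarily_large [OF Y(1), of "card D"] by blast
  obtain f where f: "bij_betw f D E"
    "\<And>a b. a \<in> D \<Longrightarrow> b \<in> D \<Longrightarrow> (f a, f b) \<in> rat_less \<longleftrightarrow> (a, b) \<in> rat_less"
    using finite_orders_isomorphic [OF strict_linear_order_rat_less strict_linear_order_rat_less
        \<open>finite D\<close> E(2) E(3) [symmetric]] by blast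
  obtain g where g: "g \<in> rat_aut" "\<And>a. a \<in> D \<Longrightarrow> g a = f a"
    using rat_aut_extend [OF \<open>finite D\<close>, of f] f(2) by blast
  have "idx (c (g \<circ> h)) = t" if "h \<in> K" for h
  proof -
    have gh: "g \<circ> h \<in> rat_aut" using that K g comp_rat_aut by blast
    have "h ` C \<subseteq> D" using that by (auto simp: D_def)
    then have "(g \<circ> h) ` C \<subseteq> Y"
      using g(2) f(1) E(1) unfolding bij_betw_def by fastforce
    moreover have "card ((g \<circ> h) ` C) = card C"
      by (rule card_image) (meson gh rat_aut_bij bij_is_inj inj_on_subset subset_UNIV)
    ultimately show ?thesis using Y(2) col [OF gh] \<open>finite C\<close> by (metis finite_imageI)
  qed
  moreover have "c (g \<circ> h) \<in> c ` rat_aut" if "h \<in> K" for h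
    using that K g comp_rat_aut by blast
  ultimately have "c (g \<circ> h) = c (g \<circ> h')" if "h \<in> K" "h' \<in> K" for h h'
    using that inj_onD [OF idx(2), of "c (g \<circ> h)" "c (g \<circ> h')"] by simp
  then show thesis using that g(1) by blast
qed


section \<open>Isometries of the Baire space\<close>

text \<open>
  The nodes of the tree of finite sequences are coded by sequences that vanish from some index on,
  so that two points lie in the same closed ball of radius \<open>1 / (n + 1)\<close> iff their truncations at
  \<open>n\<close> agree.
\<close>

definition trunc :: "nat \<Rightarrow> baire \<Rightarrow> baire" where
  "trunc n x = (\<lambda>i. if i < n then x i else 0)"

lemma trunc_eq_iff: "trunc n x = trunc n y \<longleftrightarrow> (\<forall>i<n. x i = y i)"
  by (auto simp: trunc_def fun_eq_iff)

lemma trunc_eq_mono: "trunc n x = trunc n y \<Longrightarrow> m \<le> n \<Longrightarrow> trunc m x = trunc m y"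
  by (simp add: trunc_eq_iff)

lemma trunc_Suc_eq_iff: "trunc (Suc n) x = trunc (Suc n) y \<longleftrightarrow> trunc n x = trunc n y \<and> x n = y n"
  by (auto simp: trunc_eq_iff less_Suc_eq)

lemma first_difference:
  assumes "x \<noteq> y"
  obtains n where "trunc n x = trunc n y" "x n \<noteq> y n"
proof -
  have "\<exists>n. x n \<noteq> y n" using assms by auto
  then have "x (LEAST n. x n \<noteq> y n) \<noteq> y (LEAST n. x n \<noteq> y n)" by (rule LeastI_ex)
  moreover have "trunc (LEAST n. x n \<noteq> y n) x = trunc (LEAST n. x n \<noteq> y n) y"
    unfolding trunc_eq_iff using not_less_Least by blast
  ultimately show thesis by (rule that [rotated])
qed

lemma first_difference_unique:
  assumes "trunc m x = trunc m y" "x m \<noteq> y m" "trunc n x = trunc n y" "x n \<noteq> y n"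
  shows "m = n"
  using assms unfolding trunc_eq_iff by (meson linorder_neqE_nat)

lemma baire_dist_first_difference:
  assumes "trunc n x = trunc n y" "x n \<noteq> y n"
  shows "baire_dist x y = 1 / (real n + 1)"
proof -
  have "(LEAST n. x n \<noteq> y n) = n"
  proof (rule Least_equality)
    show "n \<le> i" if "x i \<noteq> y i" for i
    proof (rule leI, rule notI)
      assume "i < n"
      then show False using that assms(1) unfolding trunc_eq_iff by blast
    qed
  qed (rule assms)
  then show ?thesis using assms by (auto simp: baire_dist_def)
qed

lemma baire_dist_le_iff: "baire_dist x y \<le> 1 / (real n + 1) \<longleftrightarrow> trunc n x = trunc n y"
proof (cases "x = y")
  case True
  then show ?thesis by (simp add: baire_dist_def)
next
  case False
  then obtain m where m: "trunc m x = trunc m y" "x m \<noteq> y m" by (rule first_difference)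
  have "1 / (real m + 1) \<le> 1 / (real n + 1) \<longleftrightarrow> n \<le> m" by (simp add: field_simps)
  also have "n \<le> m \<longleftrightarrow> trunc n x = trunc n y"
    using m by (metis trunc_eq_mono trunc_eq_iff not_le)
  finally show ?thesis using baire_dist_first_difference [OF m] by simp
qed

text \<open>So isometries are the automorphisms of the tree of finite sequences.\<close>

lemma iso_baire_iff:
  "g \<in> carrier iso_baire \<longleftrightarrow>
     bij g \<and> (\<forall>n x y. trunc n (g x) = trunc n (g y) \<longleftrightarrow> trunc n x = trunc n y)"
proof -
  have "baire_dist u v \<le> baire_dist x y"
    if "\<And>n. trunc n x = trunc n y \<Longrightarrow> trunc n u = trunc n v" for u v x y :: baire
  proof (cases "x = y")
    case True
    have "u = v"
    proof (rule ccontr)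
      assume "u \<noteq> v"
      then obtain n where "trunc n u = trunc n v" "u n \<noteq> v n" by (rule first_difference)
      then show False using that [of "Suc n"] True by (simp add: trunc_Suc_eq_iff)
    qed
    then show ?thesis using True by (simp add: baire_dist_def)
  next
    case False
    then obtain m where m: "trunc m x = trunc m y" "x m \<noteq> y m" by (rule first_difference)
    then show ?thesis
      using that [OF m(1)] by (simp add: baire_dist_le_iff baire_dist_first_difference)
  qed
  then have "baire_dist u v = baire_dist x y"
    if "\<And>n. trunc n u = trunc n v \<longleftrightarrow> trunc n x = trunc n y" for u v x y :: baire
    using that by (metis order_antisym)
  then show ?thesis
    by (auto simp: iso_baire_def simp flip: baire_dist_le_iff)
qed

lemma iso_bij: "g \<in> carrier iso_baire \<Longrightarrow> bij g"
  by (simp add: iso_baire_iff)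

lemma iso_trunc:
  "g \<in> carrier iso_baire \<Longrightarrow> trunc n (g x) = trunc n (g y) \<longleftrightarrow> trunc n x = trunc n y"
  by (simp add: iso_baire_iff)

lemma iso_inv_left: "g \<in> carrier iso_baire \<Longrightarrow> inv_into UNIV g (g x) = x"
  by (simp add: iso_bij bij_is_inj)

lemma iso_inv_right: "g \<in> carrier iso_baire \<Longrightarrow> g (inv_into UNIV g x) = x"
  by (simp add: iso_bij bij_is_surj surj_f_inv_f)

lemma iso_inv_closed: "g \<in> carrier iso_baire \<Longrightarrow> inv_into UNIV g \<in> carrier iso_baire"
  using iso_trunc [of g _ "inv_into UNIV g x" "inv_into UNIV g y" for x y]
  by (simp add: iso_baire_iff [of "inv_into UNIV g"] iso_bij bij_imp_bij_inv iso_inv_right)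

lemma mult_iso_baire [simp]: "g \<otimes>\<^bsub>iso_baire\<^esub> h = g \<circ> h"
  by (simp add: iso_baire_def)

lemma one_iso_baire [simp]: "\<one>\<^bsub>iso_baire\<^esub> = id"
  by (simp add: iso_baire_def)

lemma group_iso_baire: "group iso_baire"
proof (rule groupI)
  fix g assume g: "g \<in> carrier iso_baire"
  then have "inv_into UNIV g \<circ> g = id" by (auto simp: iso_inv_left)
  then show "\<exists>h\<in>carrier iso_baire. h \<otimes>\<^bsub>iso_baire\<^esub> g = \<one>\<^bsub>iso_baire\<^esub>"
    using iso_inv_closed [OF g] by auto
qed (auto simp: iso_baire_iff bij_comp comp_assoc)

lemma inv_iso_baire:
  assumes "g \<in> carrier iso_baire"
  shows "inv\<^bsub>iso_baire\<^esub> g = inv_into UNIV g"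
  by (rule group.inv_equality [OF group_iso_baire])
    (use assms iso_inv_closed in \<open>auto simp: iso_inv_left\<close>)

lemma comp_iso: "g \<in> carrier iso_baire \<Longrightarrow> h \<in> carrier iso_baire \<Longrightarrow> g \<circ> h \<in> carrier iso_baire"
  using group.is_monoid [OF group_iso_baire] monoid.m_closed by force


section \<open>The topology of pointwise convergence\<close>

definition iso_nbhd :: "baire set \<Rightarrow> nat \<Rightarrow> (baire \<Rightarrow> baire) \<Rightarrow> (baire \<Rightarrow> baire) set" where
  "iso_nbhd F n g = {h \<in> carrier iso_baire. \<forall>x\<in>F. trunc n (h x) = trunc n (g x)}"

lemma openin_cone: "openin baire.mtopology {y. trunc n y = trunc n z}"
  unfolding baire.openin_mtopology
proof (intro conjI allI impI)
  fix y assume y: "y \<in> {y. trunc n y = trunc n z}"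
  have "baire.mball y (1 / (real n + 1)) \<subseteq> {y. trunc n y = trunc n z}"
  proof
    fix w assume "w \<in> baire.mball y (1 / (real n + 1))"
    then have "baire_dist y w \<le> 1 / (real n + 1)" by (simp add: baire.in_mball)
    then show "w \<in> {y. trunc n y = trunc n z}" using y by (simp add: baire_dist_le_iff)
  qed
  then show "\<exists>r>0. baire.mball y r \<subseteq> {y. trunc n y = trunc n z}"
    by (intro exI [of _ "1 / (real n + 1)"]) simp
qed simp

lemma cone_subset_open:
  assumes "openin baire.mtopology U" "z \<in> U"
  obtains n where "{y. trunc n y = trunc n z} \<subseteq> U"
proof -
  obtain r where r: "r > 0" "baire.mball z r \<subseteq> U"
    using assms by (auto simp: baire.openin_mtopology)
  obtain n where "inverse (real (Suc n)) < r"
    using reals_Archimedean [OF r(1)] by blast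
  then have n: "1 / (real n + 1) < r" by (simp add: field_simps)
  have "{y. trunc n y = trunc n z} \<subseteq> baire.mball z r"
  proof
    fix y assume "y \<in> {y. trunc n y = trunc n z}"
    then have "baire_dist z y \<le> 1 / (real n + 1)" by (simp add: baire_dist_le_iff)
    then show "y \<in> baire.mball z r" using n by (simp add: baire.in_mball)
  qed
  then show thesis using r that by blast
qed

lemma topspace_iso_baire_topology [simp]:
  "topspace iso_baire_topology = carrier iso_baire"
  by (simp add: iso_baire_topology_def)

lemma openin_iso_nbhd:
  assumes "finite F"
  shows "openin iso_baire_topology (iso_nbhd F n g)"
  using assms
proof (induction F rule: finite_induct)
  case empty
  then show ?case
    using openin_topspace [of iso_baire_topology] by (simp add: iso_nbhd_def)
next
  case (insert x F)
  have "continuous_map iso_baire_topology baire.mtopology (\<lambda>h. h x)"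
    unfolding iso_baire_topology_def
    by (intro continuous_map_from_subtopology
        continuous_map_product_projection [where X = "\<lambda>_. baire.mtopology"]) simp
  from openin_continuous_map_preimage [OF this openin_cone [of n "g x"]]
  have "openin iso_baire_topology {h \<in> carrier iso_baire. trunc n (h x) = trunc n (g x)}"
    by simp
  then have "openin iso_baire_topology
    ({h \<in> carrier iso_baire. trunc n (h x) = trunc n (g x)} \<inter> iso_nbhd F n g)"
    using insert.IH by (rule openin_Int)
  also have "{h \<in> carrier iso_baire. trunc n (h x) = trunc n (g x)} \<inter> iso_nbhd F n g
    = iso_nbhd (insert x F) n g"
    by (auto simp: iso_nbhd_def)
  finally show ?case .
qed

lemma iso_nbhd_base:
  assumes "openin iso_baire_topology U" "g \<in> U"
  obtains F n where "finite F" "iso_nbhd F n g \<subseteq> U"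
proof -
  obtain W where W: "openin (product_topology (\<lambda>_. baire.mtopology) UNIV) W"
    "U = W \<inter> carrier iso_baire"
    using assms(1) unfolding iso_baire_topology_def openin_subtopology by blast
  then obtain V where V: "finite {x. V x \<noteq> UNIV}" "\<And>x. openin baire.mtopology (V x)"
    "\<And>x. g x \<in> V x" "Pi\<^sub>E UNIV V \<subseteq> W"
    using assms(2) unfolding openin_product_topology_alt by (force simp: PiE_def Pi_def)
  define F where "F = {x. V x \<noteq> UNIV}"
  have "\<exists>n. {y. trunc n y = trunc n (g x)} \<subseteq> V x" for x
    by (rule cone_subset_open [OF V(2) V(3)]) blast
  then obtain k where k: "\<And>x. {y. trunc (k x) y = trunc (k x) (g x)} \<subseteq> V x" by metis
  define n where "n = Max (insert 0 (k ` F))"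
  have "k x \<le> n" if "x \<in> F" for x
    using that V(1) unfolding n_def F_def by (intro Max_ge) auto
  then have "h x \<in> V x" if "h \<in> iso_nbhd F n g" for h x
    using that k [of x] trunc_eq_mono unfolding iso_nbhd_def F_def by blast
  then have "iso_nbhd F n g \<subseteq> U"
    using V(4) W(2) by (fastforce simp: iso_nbhd_def)
  then show thesis using that V(1) by (simp add: F_def)
qed

lemma iso_nbhd_self: "g \<in> carrier iso_baire \<Longrightarrow> g \<in> iso_nbhd F n g"
  by (simp add: iso_nbhd_def)

text \<open>Inversion is continuous because \<open>h\<close> is an isometry: \<open>z\<close> is close to \<open>h (g\<inverse> z)\<close>.\<close>

lemma trunc_inv_iso_nbhd:
  assumes "h \<in> iso_nbhd F n g" "g \<in> carrier iso_baire" "inv_into UNIV g z \<in> F"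
  shows "trunc n (inv_into UNIV h z) = trunc n (inv_into UNIV g z)"
proof -
  have h: "h \<in> carrier iso_baire" "trunc n (h (inv_into UNIV g z)) = trunc n z"
    using assms by (auto simp: iso_nbhd_def iso_inv_right)
  then show ?thesis
    using iso_trunc [OF h(1), of n "inv_into UNIV h z" "inv_into UNIV g z"]
    by (simp add: iso_inv_right)
qed

lemma continuous_map_to_baire:
  assumes "\<And>x n. x \<in> topspace X \<Longrightarrow>
    \<exists>U. openin X U \<and> x \<in> U \<and> (\<forall>y\<in>U. trunc n (f y) = trunc n (f x))"
  shows "continuous_map X baire.mtopology f"
  unfolding baire.continuous_map_to_metric
proof (intro ballI allI impI)
  fix x and e :: real
  assume x: "x \<in> topspace X" and "e > 0"
  then have "f x \<in> baire.mball (f x) e" by (simp add: baire.in_mball)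
  then obtain n where n: "{y. trunc n y = trunc n (f x)} \<subseteq> baire.mball (f x) e"
    by (rule cone_subset_open [OF baire.openin_mball])
  then show "\<exists>U. openin X U \<and> x \<in> U \<and> (\<forall>y\<in>U. f y \<in> baire.mball (f x) e)"
    using assms [OF x, of n] by blast
qed

lemma continuous_map_to_iso:
  assumes "\<And>g z n. g \<in> topspace X \<Longrightarrow>
      \<exists>U. openin X U \<and> g \<in> U \<and> (\<forall>h\<in>U. trunc n (f h z) = trunc n (f g z))"
    and "\<And>g. g \<in> topspace X \<Longrightarrow> f g \<in> carrier iso_baire"
  shows "continuous_map X iso_baire_topology f"
  unfolding iso_baire_topology_def continuous_map_in_subtopology continuous_map_componentwise_UNIV
  using assms by (auto intro!: continuous_map_to_baire)

lemma topological_group_iso_baire: "topological_group iso_baire iso_baire_topology"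
proof -
  interpret group iso_baire by (rule group_iso_baire)
  show ?thesis
  proof
    show "continuous_map (prod_topology iso_baire_topology iso_baire_topology) iso_baire_topology
        (\<lambda>(g, h). g \<otimes>\<^bsub>iso_baire\<^esub> h)"
    proof (rule continuous_map_to_iso, goal_cases)
      case (1 p z n)
      obtain g h where p: "p = (g, h)" "g \<in> carrier iso_baire" "h \<in> carrier iso_baire"
        using 1 by auto
      show ?case
      proof (intro exI conjI ballI)
        show "openin (prod_topology iso_baire_topology iso_baire_topology)
            (iso_nbhd {h z} n g \<times> iso_nbhd {z} n h)"
          by (simp add: openin_prod_Times_iff openin_iso_nbhd)
        show "p \<in> iso_nbhd {h z} n g \<times> iso_nbhd {z} n h"
          using p by (simp add: iso_nbhd_self)
      next
        fix q assume "q \<in> iso_nbhd {h z} n g \<times> iso_nbhd {z} n h"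
        then show "trunc n ((case q of (g, h) \<Rightarrow> g \<otimes>\<^bsub>iso_baire\<^esub> h) z) =
            trunc n ((case p of (g, h) \<Rightarrow> g \<otimes>\<^bsub>iso_baire\<^esub> h) z)"
          using p iso_trunc [of "fst q" n "snd q z" "h z"] by (auto simp: iso_nbhd_def)
      qed
    next
      case (2 p)
      then show ?case by (auto intro: comp_iso)
    qed
    show "continuous_map iso_baire_topology iso_baire_topology (\<lambda>g. inv\<^bsub>iso_baire\<^esub> g)"
    proof (rule continuous_map_to_iso, goal_cases)
      case (1 g z n)
      then have g: "g \<in> carrier iso_baire" by simp
      let ?w = "inv_into UNIV g z"
      have "trunc n (inv_into UNIV h z) = trunc n ?w" if "h \<in> iso_nbhd {?w} n g" for h
        using trunc_inv_iso_nbhd [OF that g] by simp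
      moreover have "iso_nbhd {?w} n g \<subseteq> carrier iso_baire" by (auto simp: iso_nbhd_def)
      ultimately have "\<forall>h\<in>iso_nbhd {?w} n g.
          trunc n ((inv\<^bsub>iso_baire\<^esub> h) z) = trunc n ((inv\<^bsub>iso_baire\<^esub> g) z)"
        using g by (auto simp: inv_iso_baire subset_iff)
      then show ?case
        using openin_iso_nbhd [of "{?w}" n g] iso_nbhd_self [OF g, of "{?w}" n] by blast
    next
      case (2 g)
      then show ?case by simp
    qed
  qed simp
qed


section \<open>Isometries that change one coordinate\<close>

text \<open>The family \<open>\<alpha>\<close> permutes the successors of each node of length \<open>n\<close>, rigidly below them.\<close>

definition level :: "nat \<Rightarrow> (baire \<Rightarrow> nat \<Rightarrow> nat) \<Rightarrow> baire \<Rightarrow> baire" where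
  "level n \<alpha> x = x(n := \<alpha> (trunc n x) (x n))"

lemma trunc_level: "m \<le> n \<Longrightarrow> trunc m (level n \<alpha> x) = trunc m x"
  by (simp add: level_def trunc_eq_iff)

lemma trunc_fun_upd: "m \<le> n \<Longrightarrow> trunc m (x(n := a)) = trunc m x"
  by (simp add: trunc_eq_iff)

lemma level_level: "level n \<alpha> (level n \<beta> x) = level n (\<lambda>s. \<alpha> s \<circ> \<beta> s) x"
  by (simp add: level_def trunc_fun_upd)

lemma level_id: "(\<And>s. \<alpha> s = id) \<Longrightarrow> level n \<alpha> = id"
  by (simp add: level_def fun_eq_iff)

lemma level_iso:
  assumes "\<And>s. bij (\<alpha> s)"
  shows "level n \<alpha> \<in> carrier iso_baire"
proof -
  note inj = assms [THEN bij_is_inj] and surj = assms [THEN bij_is_surj]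
  let ?\<beta> = "\<lambda>s. inv_into UNIV (\<alpha> s)"
  have "?\<beta> s \<circ> \<alpha> s = id" "\<alpha> s \<circ> ?\<beta> s = id" for s
    using inj [of s] surj [of s] by (auto simp: surj_f_inv_f)
  then have "level n ?\<beta> (level n \<alpha> x) = x" "level n \<alpha> (level n ?\<beta> x) = x" for x
    by (simp_all add: level_level level_id)
  then have "bij (level n \<alpha>)"
    by (intro bij_betw_byWitness [where f' = "level n ?\<beta>"]) auto
  moreover have "trunc m (level n \<alpha> x) = trunc m (level n \<alpha> y) \<longleftrightarrow> trunc m x = trunc m y" for m x y
  proof (induction m)
    case (Suc m)
    consider "m < n" | "m = n" | "n < m" by linarith
    then show ?case
    proof cases
      case 2
      then show ?thesis
        using Suc inj_eq [OF inj]
        by (auto simp: trunc_Suc_eq_iff trunc_level) (auto simp: level_def)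
    qed (use Suc in \<open>auto simp: trunc_Suc_eq_iff level_def\<close>)
  qed (simp add: trunc_def)
  ultimately show ?thesis by (simp add: iso_baire_iff)
qed

definition node :: "nat \<Rightarrow> baire \<Rightarrow> (nat \<Rightarrow> nat) \<Rightarrow> baire \<Rightarrow> baire" where
  "node n s p = level n ((\<lambda>_. id)(s := p))"

lemma node_apply: "node n s p x = (if trunc n x = s then x(n := p (x n)) else x)"
  by (simp add: node_def level_def)

lemma node_iso: "bij p \<Longrightarrow> node n s p \<in> carrier iso_baire"
  unfolding node_def by (rule level_iso) simp

lemma node_comp: "node n s p \<circ> node n s q = node n s (p \<circ> q)"
  by (auto simp: fun_eq_iff node_apply trunc_fun_upd)

lemma node_commute:
  "s \<noteq> t \<Longrightarrow> node n t q \<circ> node n s p = node n s p \<circ> node n t q"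
  by (intro ext) (auto simp: node_apply trunc_fun_upd)

text \<open>
  An isometry that is rigid below level \<open>n\<close> conjugates the permutations of the successors of one
  node of length \<open>n\<close> to those of another.
\<close>

lemma node_conjugate:
  assumes "bij p" "m < n"
  obtains u where "\<And>q. node n t q \<circ> node m s p = node m s p \<circ> node n u q"
proof -
  have g: "node m s p \<in> carrier iso_baire" using assms(1) by (rule node_iso)
  \<comment> \<open>The preimage of the node \<open>t\<close>. If \<open>t\<close> is not a truncation, any \<open>u\<close> that is not one either
    will do; truncations vanish eventually, so the constant 1 is not one.\<close>
  define u where "u = (if \<exists>x. trunc n (node m s p x) = t
    then trunc n (SOME x. trunc n (node m s p x) = t) else (\<lambda>_. 1))"
  have no: "trunc n x \<noteq> (\<lambda>_. 1)" for x
    by (metis less_irrefl trunc_def zero_neq_one)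
  have u: "trunc n (node m s p x) = t \<longleftrightarrow> trunc n x = u" for x
  proof (cases "\<exists>x. trunc n (node m s p x) = t")
    case True
    then have "trunc n (node m s p (SOME x. trunc n (node m s p x) = t)) = t" by (rule someI_ex)
    then show ?thesis using True iso_trunc [OF g] unfolding u_def by metis
  next
    case False
    then show ?thesis using no by (simp add: u_def)
  qed
  have "node n t q (node m s p x) = node m s p (node n u q x)" for q x
  proof -
    have "trunc m (x(n := a)) = trunc m x" for a using assms(2) by (simp add: trunc_fun_upd)
    then have "node m s p (x(n := a)) = (node m s p x)(n := a)" "node m s p x n = x n" for a
      using assms(2) by (auto simp: node_apply)
    then show ?thesis by (simp add: node_apply [of n] u)
  qed
  then show thesis by (intro that [of u] ext) simp
qed

text \<open>A finitely supported family acts as a finite product of permutations at single nodes.\<close>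

lemma level_in_subgroup:
  assumes "subgroup L iso_baire" "finite S"
    and "\<And>s. s \<in> S \<Longrightarrow> node n s (\<alpha> s) \<in> L" "\<And>s. s \<notin> S \<Longrightarrow> \<alpha> s = id"
  shows "level n \<alpha> \<in> L"
  using assms(2-)
proof (induction S arbitrary: \<alpha> rule: finite_induct)
  case empty
  then have "level n \<alpha> = id" by (intro level_id) blast
  then show ?case using subgroup.one_closed [OF assms(1)] by (metis one_iso_baire)
next
  case (insert s S)
  have "level n (\<alpha>(s := id)) \<in> L"
    using insert by (intro insert.IH) auto
  moreover have "level n \<alpha> = node n s (\<alpha> s) \<circ> level n (\<alpha>(s := id))"
    unfolding node_def by (intro ext) (auto simp: level_def trunc_fun_upd)
  moreover have "node n s (\<alpha> s) \<in> L" using insert.prems(1) by blast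
  ultimately show ?case
    using subgroup.m_closed [OF assms(1), of "node n s (\<alpha> s)" "level n (\<alpha>(s := id))"]
    by (simp only: mult_iso_baire)
qed


section \<open>The flow of convex orderings\<close>

lemma mcball_baire: "baire.mcball x (1 / (real n + 1)) = {y. trunc n y = trunc n x}"
  by (auto simp: baire.in_mcball baire_dist_le_iff)

text \<open>
  Convexity of the closed balls of radius \<open>1 / (n + 1)\<close> suffices: a point between \<open>a\<close> and \<open>c\<close> is at most as
  far from \<open>a\<close> as \<open>c\<close> is, and then the ultrametric inequality keeps it in every ball that contains
  \<open>a\<close> and \<open>c\<close>.
\<close>

lemma cLO_iff:
  "r \<in> cLO \<longleftrightarrow> strict_linear_order r \<and>
    (\<forall>n x y z. trunc n x = trunc n z \<longrightarrow> (x, y) \<in> r \<longrightarrow> (y, z) \<in> r \<longrightarrow> trunc n y = trunc n x)"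
    (is "_ \<longleftrightarrow> _ \<and> ?conv")
proof (intro iffI conjI)
  assume r: "r \<in> cLO"
  then show "strict_linear_order r" by (simp add: cLO_def)
  show ?conv
  proof (intro allI impI)
    fix n x y z assume *: "trunc n x = trunc n z" "(x, y) \<in> r" "(y, z) \<in> r"
    have "order_convex r (baire.mcball x (1 / (real n + 1)))"
      using r unfolding cLO_def by blast
    moreover have "x \<in> baire.mcball x (1 / (real n + 1))" "z \<in> baire.mcball x (1 / (real n + 1))"
      using *(1) by (simp_all add: mcball_baire)
    ultimately have "y \<in> baire.mcball x (1 / (real n + 1))"
      using *(2,3) unfolding order_convex_def by meson
    then show "trunc n y = trunc n x" by (simp add: mcball_baire)
  qed
next
  assume *: "strict_linear_order r \<and> ?conv"
  note lin = conjunct1 [OF *] and conv = conjunct2 [OF *]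
  have between: "baire_dist w b \<le> max (baire_dist w a) (baire_dist w c)"
    if "(a, b) \<in> r" "(b, c) \<in> r" for a b c w
  proof -
    have "a \<noteq> c" using that strict_linear_orderD(3) [OF lin] by blast
    then obtain n where n: "trunc n a = trunc n c" "a n \<noteq> c n" by (rule first_difference)
    have "trunc n b = trunc n a" using conv n(1) that by blast
    then have "baire_dist a b \<le> baire_dist a c"
      by (simp add: baire_dist_le_iff baire_dist_first_difference [OF n])
    then show ?thesis
      using baire_dist_ultra [of w b a] baire_dist_ultra [of a c w] baire.commute [of a w]
      by simp
  qed
  have "order_convex r (baire.mball w e)" "order_convex r (baire.mcball w e)" for w e
    unfolding order_convex_def
    using between [of _ _ _ w] by (fastforce simp: baire.in_mball baire.in_mcball)+
  then show "r \<in> cLO" using lin by (simp add: cLO_def)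
qed

lemma cLO_linear: "r \<in> cLO \<Longrightarrow> strict_linear_order r"
  by (simp add: cLO_iff)

text \<open>Disjoint balls are ordered as blocks, so only the first difference of two points matters.\<close>

lemma cLO_blocks:
  assumes r: "r \<in> cLO" and eq: "trunc n x = trunc n x'" "trunc n y = trunc n y'"
    and ne: "trunc n x \<noteq> trunc n y"
  shows "(x, y) \<in> r \<longleftrightarrow> (x', y') \<in> r"
proof -
  have "(x', y') \<in> r"
    if xy: "(x, y) \<in> r" and eq: "trunc n x = trunc n x'" "trunc n y = trunc n y'"
      and ne: "trunc n x \<noteq> trunc n y" for x y x' y'
  proof -
    note lin = strict_linear_orderD [OF cLO_linear [OF r]]
    have conv: "trunc n b = trunc n a"
      if "trunc n a = trunc n c" "(a, b) \<in> r" "(b, c) \<in> r" for a b c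
      using r that unfolding cLO_iff by blast
    have "x' \<noteq> y" using eq ne by auto
    have "(y, x') \<notin> r" using conv [of x x' y] xy eq ne by auto
    then have x'y: "(x', y) \<in> r" using lin(4) \<open>x' \<noteq> y\<close> by blast
    have "x' \<noteq> y'" using eq ne by auto
    have "(y', x') \<notin> r" using conv [of y' y x'] x'y eq ne by auto
    then show ?thesis using lin(4) \<open>x' \<noteq> y'\<close> by blast
  qed
  from this [of x y x' y'] this [of x' y' x y] show ?thesis using eq ne by auto
qed

lemma cLO_action_iff:
  "r \<in> cLO \<Longrightarrow> (x, y) \<in> cLO_action g r \<longleftrightarrow> (inv_into UNIV g x, inv_into UNIV g y) \<in> r"
  by (simp add: cLO_action_def)

lemma cLO_action_image:
  "g \<in> carrier iso_baire \<Longrightarrow> r \<in> cLO \<Longrightarrow> (g x, g y) \<in> cLO_action g r \<longleftrightarrow> (x, y) \<in> r"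
  by (simp add: cLO_action_iff iso_inv_left)

lemma cLO_action_closed:
  assumes g: "g \<in> carrier iso_baire" and r: "r \<in> cLO"
  shows "cLO_action g r \<in> cLO"
  unfolding cLO_iff
proof (intro conjI allI impI)
  have "cLO_action g r = inv_image r (inv_into UNIV g)"
    using r by (auto simp: cLO_action_iff)
  moreover have "inj (inv_into UNIV g)"
    using iso_bij [OF iso_inv_closed [OF g]] by (rule bij_is_inj)
  ultimately show "strict_linear_order (cLO_action g r)"
    using strict_linear_order_inv_image cLO_linear [OF r] by metis
next
  fix n x y z
  assume "trunc n x = trunc n z" "(x, y) \<in> cLO_action g r" "(y, z) \<in> cLO_action g r"
  then have "trunc n (inv_into UNIV g y) = trunc n (inv_into UNIV g x)"
    using r iso_trunc [OF iso_inv_closed [OF g]] unfolding cLO_action_iff [OF r] cLO_iff by blast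
  then show "trunc n y = trunc n x" using iso_trunc [OF iso_inv_closed [OF g]] by blast
qed

lemma cLO_action_comp:
  assumes "g \<in> carrier iso_baire" "h \<in> carrier iso_baire" "r \<in> cLO"
  shows "cLO_action (g \<circ> h) r = cLO_action g (cLO_action h r)"
proof -
  have "inv_into UNIV (g \<circ> h) = inv_into UNIV h \<circ> inv_into UNIV g"
    using assms by (intro o_inv_distrib iso_bij)
  then show ?thesis
    using assms by (auto simp: cLO_action_iff cLO_action_closed)
qed

lemma cLO_action_id: "r \<in> cLO \<Longrightarrow> cLO_action id r = r"
  by (auto simp: cLO_action_iff inv_id)

lemma group_action_cLO: "group_action iso_baire cLO cLO_action"
proof -
  have Bij: "cLO_action g \<in> Bij cLO" if g: "g \<in> carrier iso_baire" for g
  proof -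
    let ?h = "inv_into UNIV g"
    have h: "?h \<in> carrier iso_baire" using g by (rule iso_inv_closed)
    have "g \<circ> ?h = id" "?h \<circ> g = id"
      using g by (auto simp: iso_inv_left iso_inv_right)
    then have "cLO_action g (cLO_action ?h r) = r" "cLO_action ?h (cLO_action g r) = r"
      if "r \<in> cLO" for r
      using cLO_action_comp [OF g h that] cLO_action_comp [OF h g that] cLO_action_id [OF that]
      by simp_all
    then have "bij_betw (cLO_action g) cLO cLO"
      using g h by (intro bij_betw_byWitness [where f' = "cLO_action ?h"])
        (auto simp: cLO_action_closed)
    then show ?thesis by (simp add: Bij_def cLO_action_def)
  qed
  have "group_hom iso_baire (BijGroup cLO) cLO_action"
  proof (intro group_hom.intro group_hom_axioms.intro homI)
    fix g h assume gh: "g \<in> carrier iso_baire" "h \<in> carrier iso_baire"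
    have "cLO_action (g \<circ> h) r = compose cLO (cLO_action g) (cLO_action h) r" for r
    proof (cases "r \<in> cLO")
      case True
      then show ?thesis using gh by (simp add: cLO_action_comp compose_eq)
    next
      case False
      then show ?thesis by (simp add: cLO_action_def compose_def)
    qed
    then show "cLO_action (g \<otimes>\<^bsub>iso_baire\<^esub> h) = cLO_action g \<otimes>\<^bsub>BijGroup cLO\<^esub> cLO_action h"
      using gh Bij by (auto simp: BijGroup_def fun_eq_iff)
  qed (auto simp: Bij BijGroup_def group_iso_baire group_BijGroup [unfolded BijGroup_def])
  then show ?thesis by (rule group_action.intro)
qed

lemma openin_cLO_pair:
  shows "openin cLO_topology {s \<in> cLO. (x, y) \<in> s \<longleftrightarrow> b}"
proof (subst openin_subopen, intro ballI)
  fix r assume r: "r \<in> {s \<in> cLO. (x, y) \<in> s \<longleftrightarrow> b}"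
  let ?T = "{s \<in> cLO. Restr s {x, y} = Restr r {x, y}}"
  have "openin cLO_topology ?T"
    unfolding cLO_topology_def using r by (intro topology_generated_by_Basis) blast
  moreover have "?T \<subseteq> {s \<in> cLO. (x, y) \<in> s \<longleftrightarrow> b}"
    using r by blast
  ultimately show "\<exists>T. openin cLO_topology T \<and> r \<in> T \<and> T \<subseteq> {s \<in> cLO. (x, y) \<in> s \<longleftrightarrow> b}"
    using r by blast
qed

lemma cLO_topology_base:
  assumes "openin cLO_topology U" "r \<in> U"
  obtains F where "finite F" "\<And>s. s \<in> cLO \<Longrightarrow> Restr s F = Restr r F \<Longrightarrow> s \<in> U"
proof -
  have "generate_topology_on {{s \<in> cLO. Restr s F = Restr r F} | F r. finite F \<and> r \<in> cLO} U"
    using assms(1) unfolding cLO_topology_def openin_topology_generated_by_iff .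
  then have "\<forall>r\<in>U. \<exists>F. finite F \<and> (\<forall>s\<in>cLO. Restr s F = Restr r F \<longrightarrow> s \<in> U)"
  proof induction
    case (Int a b)
    show ?case
    proof
      fix r assume r: "r \<in> a \<inter> b"
      have "\<exists>F. finite F \<and> (\<forall>s\<in>cLO. Restr s F = Restr r F \<longrightarrow> s \<in> a)"
        using Int.IH(1) r by (rule bspec [OF _ IntD1])
      then obtain F where F: "finite F" "\<forall>s\<in>cLO. Restr s F = Restr r F \<longrightarrow> s \<in> a"
        by (elim exE conjE)
      have "\<exists>F. finite F \<and> (\<forall>s\<in>cLO. Restr s F = Restr r F \<longrightarrow> s \<in> b)"
        using Int.IH(2) r by (rule bspec [OF _ IntD2])
      then obtain F' where F': "finite F'" "\<forall>s\<in>cLO. Restr s F' = Restr r F' \<longrightarrow> s \<in> b"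
        by (elim exE conjE)
      show "\<exists>F. finite F \<and> (\<forall>s\<in>cLO. Restr s F = Restr r F \<longrightarrow> s \<in> a \<inter> b)"
      proof (intro exI conjI ballI impI IntI)
        show "finite (F \<union> F')" using F(1) F'(1) by simp
      next
        fix s assume s: "s \<in> cLO" "Restr s (F \<union> F') = Restr r (F \<union> F')"
        have "Restr s F = Restr r F" using s(2) by blast
        then show "s \<in> a" using F(2) s(1) by blast
        have "Restr s F' = Restr r F'" using s(2) by blast
        then show "s \<in> b" using F'(2) s(1) by blast
      qed
    qed
  next
    case (UN K)
    show ?case
    proof
      fix r assume "r \<in> \<Union>K"
      then obtain k where k: "k \<in> K" "r \<in> k" by blast
      from UN.IH [OF k(1)] k(2)
      have "\<exists>F. finite F \<and> (\<forall>s\<in>cLO. Restr s F = Restr r F \<longrightarrow> s \<in> k)"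
        by (rule bspec)
      then obtain F where F: "finite F" "\<forall>s\<in>cLO. Restr s F = Restr r F \<longrightarrow> s \<in> k"
        by (elim exE conjE)
      show "\<exists>F. finite F \<and> (\<forall>s\<in>cLO. Restr s F = Restr r F \<longrightarrow> s \<in> \<Union>K)"
        using F by (intro exI [of _ F] conjI ballI impI UnionI [OF k(1)]) simp_all
    qed
  next
    case (Basis S)
    then obtain F t where S: "S = {s \<in> cLO. Restr s F = Restr t F}" "finite F"
      by (elim CollectE exE conjE)
    show ?case
    proof (intro ballI exI [of _ F] conjI impI)
      fix r s assume "r \<in> S" and s: "s \<in> cLO" "Restr s F = Restr r F"
      from \<open>r \<in> S\<close> have "Restr r F = Restr t F" unfolding S(1) by (elim CollectE conjE)
      with s(2) have "Restr s F = Restr t F" by (rule trans)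
      with s(1) show "s \<in> S" unfolding S(1) by (intro CollectI conjI)
    qed (rule S(2))
  qed simp
  from bspec [OF this assms(2)]
  obtain F where F: "finite F" "\<forall>s\<in>cLO. Restr s F = Restr r F \<longrightarrow> s \<in> U"
    by (elim exE conjE)
  show thesis by (rule that [OF F(1)]) (rule F(2) [rule_format])
qed

lemma continuous_map_to_cLO:
  assumes "\<And>t. t \<in> topspace X \<Longrightarrow> f t \<in> cLO"
    and loc: "\<And>t x y. t \<in> topspace X \<Longrightarrow>
      \<exists>U. openin X U \<and> t \<in> U \<and> (\<forall>u\<in>U. (x, y) \<in> f u \<longleftrightarrow> (x, y) \<in> f t)"
  shows "continuous_map X cLO_topology f"
  unfolding cLO_topology_def
proof (rule continuous_on_generated_topo)
  fix V assume "V \<in> {{s \<in> cLO. Restr s F = Restr r F} | F r. finite F \<and> r \<in> cLO}"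
  then obtain F r where V: "V = {s \<in> cLO. Restr s F = Restr r F}" "finite F" by blast
  show "openin X (f -` V \<inter> topspace X)"
  proof (subst openin_subopen, intro ballI)
    fix t assume "t \<in> f -` V \<inter> topspace X"
    then have t: "f t \<in> V" "t \<in> topspace X" by auto
    have "\<exists>U. openin X U \<and> t \<in> U \<and> (\<forall>u\<in>U. \<forall>p\<in>P. p \<in> f u \<longleftrightarrow> p \<in> f t)"
      if "finite P" for P
      using that
    proof (induction P rule: finite_induct)
      case empty
      then show ?case using t by auto
    next
      case (insert p P)
      then obtain U where U: "openin X U" "t \<in> U" "\<forall>u\<in>U. \<forall>p\<in>P. p \<in> f u \<longleftrightarrow> p \<in> f t" by blast
      obtain W where W: "openin X W" "t \<in> W" "\<forall>u\<in>W. p \<in> f u \<longleftrightarrow> p \<in> f t"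
        using loc [OF t(2), of "fst p" "snd p"] by auto
      have "\<forall>u\<in>U \<inter> W. \<forall>q\<in>insert p P. q \<in> f u \<longleftrightarrow> q \<in> f t"
        using U(3) W(3) by blast
      then show ?case
        using U(2) W(2) openin_Int [OF U(1) W(1)] by blast
    qed
    from this [of "F \<times> F"] obtain U
      where U: "openin X U" "t \<in> U" "\<forall>u\<in>U. \<forall>p\<in>F \<times> F. p \<in> f u \<longleftrightarrow> p \<in> f t"
      using V(2) by auto
    have "f u \<in> V" if "u \<in> U" for u
    proof -
      have "f u \<in> cLO" using that openin_subset [OF U(1)] assms(1) by blast
      moreover have "Restr (f u) F = Restr (f t) F"
        using U(3) that by blast
      ultimately show ?thesis using t(1) V(1) by simp
    qed
    then show "\<exists>T. openin X T \<and> t \<in> T \<and> T \<subseteq> f -` V \<inter> topspace X"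
      using U openin_subset [OF U(1)] by (intro exI [of _ U]) auto
  qed
next
  show "f ` topspace X \<subseteq> \<Union> {{s \<in> cLO. Restr s F = Restr r F} | F r. finite F \<and> r \<in> cLO}"
    using assms(1) by (intro subsetI UnionI) blast+
qed

lemma Hausdorff_cLO: "Hausdorff_space cLO_topology"
  unfolding Hausdorff_space_def
proof (intro allI impI)
  fix r t assume *: "r \<in> topspace cLO_topology \<and> t \<in> topspace cLO_topology \<and> r \<noteq> t"
  then obtain x y where xy: "(x, y) \<in> r \<longleftrightarrow> (x, y) \<notin> t" by auto
  let ?U = "\<lambda>b. {s \<in> cLO. (x, y) \<in> s \<longleftrightarrow> b}"
  have "disjnt (?U ((x, y) \<in> r)) (?U ((x, y) \<in> t))"
    using xy by (auto simp: disjnt_def)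
  then show "\<exists>U V. openin cLO_topology U \<and> openin cLO_topology V \<and> r \<in> U \<and> t \<in> V \<and> disjnt U V"
    using openin_cLO_pair * by (intro exI [of _ "?U _"] conjI) auto
qed

text \<open>
  Being a convex ordering is a closed condition on indicator functions of relations, so
  compactness is inherited from a power of the two-point space.
\<close>

lemma compact_cLO: "compact_space cLO_topology"
proof -
  let ?P = "product_topology (\<lambda>_. discrete_topology (UNIV :: bool set)) (UNIV :: (baire \<times> baire) set)"
  define C where "C = {f. Collect f \<in> cLO}"
  have op1: "openin ?P {f. f p = b}" for p b
  proof -
    have "continuous_map ?P (discrete_topology (UNIV :: bool set)) (\<lambda>f. f p)"
      by (rule continuous_map_product_projection) simp
    from openin_continuous_map_preimage [OF this, of "{b}"] show ?thesis by simp
  qed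
  have op3: "openin ?P {f. f p = a \<and> f q = b \<and> f s = c}" for p q s a b c
    using openin_Int [OF op1 openin_Int [OF op1 op1], of p a q b s c]
    by (simp add: Collect_conj_eq)
  have "openin ?P (- C)"
  proof (subst openin_subopen, intro ballI)
    fix f assume "f \<in> - C"
    then have "Collect f \<notin> cLO" by (simp add: C_def)
    then consider
        x y z where "f (x, y)" "f (y, z)" "\<not> f (x, z)"
      | x where "f (x, x)"
      | x y where "x \<noteq> y" "\<not> f (x, y)" "\<not> f (y, x)"
      | n x y z where "trunc n x = trunc n z" "f (x, y)" "f (y, z)" "trunc n y \<noteq> trunc n x"
      unfolding cLO_iff strict_linear_order_on_def trans_def irrefl_def total_on_def
      by blast
    then have "\<exists>p q s. {h. h p = f p \<and> h q = f q \<and> h s = f s} \<subseteq> - C"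
    proof cases
      case (1 x y z)
      then have "{h. h (x, y) = f (x, y) \<and> h (y, z) = f (y, z) \<and> h (x, z) = f (x, z)} \<subseteq> - C"
        by (auto simp: C_def dest!: cLO_linear dest: strict_linear_orderD(2))
      then show ?thesis by blast
    next
      case (2 x)
      then have "{h. h (x, x) = f (x, x) \<and> h (x, x) = f (x, x) \<and> h (x, x) = f (x, x)} \<subseteq> - C"
        by (auto simp: C_def dest!: cLO_linear dest: strict_linear_orderD(1))
      then show ?thesis by blast
    next
      case (3 x y)
      then have "{h. h (x, y) = f (x, y) \<and> h (y, x) = f (y, x) \<and> h (y, x) = f (y, x)} \<subseteq> - C"
        by (auto simp: C_def dest!: cLO_linear dest: strict_linear_orderD(4))
      then show ?thesis by blast
    next
      case (4 n x y z)
      then have "{h. h (x, y) = f (x, y) \<and> h (y, z) = f (y, z) \<and> h (y, z) = f (y, z)} \<subseteq> - C"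
        by (auto simp: C_def cLO_iff)
      then show ?thesis by blast
    qed
    then obtain p q s where T: "{h. h p = f p \<and> h q = f q \<and> h s = f s} \<subseteq> - C" by blast
    show "\<exists>T. openin ?P T \<and> f \<in> T \<and> T \<subseteq> - C"
      by (intro exI [of _ "{h. h p = f p \<and> h q = f q \<and> h s = f s}"] conjI op3 T) simp
  qed
  then have "closedin ?P C" by (simp add: closedin_def Compl_eq_Diff_UNIV)
  moreover have "compact_space ?P"
    by (simp add: compact_space_product_topology compact_space_discrete_topology)
  ultimately have "compactin ?P C" by (intro closedin_compact_space)
  then have "compactin (subtopology ?P C) C" by (simp add: compactin_subtopology)
  moreover have "continuous_map (subtopology ?P C) cLO_topology Collect"
  proof (rule continuous_map_to_cLO)
    show "Collect f \<in> cLO" if "f \<in> topspace (subtopology ?P C)" for f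
      using that by (simp add: C_def)
    show "\<exists>U. openin (subtopology ?P C) U \<and> f \<in> U \<and>
        (\<forall>h\<in>U. (x, y) \<in> Collect h \<longleftrightarrow> (x, y) \<in> Collect f)"
      if "f \<in> topspace (subtopology ?P C)" for f x y
      using that openin_subtopology_Int [OF op1 [of "(x, y)" "f (x, y)"], of C]
      by (intro exI [of _ "{h. h (x, y) = f (x, y)} \<inter> C"]) auto
  qed
  ultimately have "compactin cLO_topology (Collect ` C)" by (rule image_compactin)
  moreover have "Collect ` C = cLO"
  proof (intro equalityI subsetI)
    fix r assume "r \<in> cLO"
    then have "(\<lambda>p. p \<in> r) \<in> C" by (simp add: C_def)
    then show "r \<in> Collect ` C" by (rule rev_image_eqI) simp
  qed (auto simp: C_def)
  ultimately show ?thesis by (simp add: compact_space_def)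
qed


lemma separating_level:
  assumes "finite F"
  obtains n where "\<And>x y. x \<in> F \<Longrightarrow> y \<in> F \<Longrightarrow> x \<noteq> y \<Longrightarrow> trunc n x \<noteq> trunc n y"
proof -
  have "\<exists>n. trunc n x \<noteq> trunc n y" if ne: "x \<noteq> y" for x y
  proof -
    obtain m where m: "trunc m x = trunc m y" "x m \<noteq> y m"
      using ne by (rule first_difference)
    have "trunc (Suc m) x \<noteq> trunc (Suc m) y"
      using m(2) by (simp add: trunc_Suc_eq_iff)
    then show ?thesis by blast
  qed
  then obtain k where k: "\<And>x y. x \<noteq> y \<Longrightarrow> trunc (k x y) x \<noteq> trunc (k x y) y" by metis
  define n where "n = Max (insert 0 ((\<lambda>(x, y). k x y) ` (F \<times> F)))"
  have "trunc n x \<noteq> trunc n y" if "x \<in> F" "y \<in> F" "x \<noteq> y" for x y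
  proof -
    have "k x y \<le> n" unfolding n_def using assms that by (intro Max_ge) auto
    then show ?thesis using k [OF that(3)] trunc_eq_mono by blast
  qed
  then show thesis by (rule that)
qed

text \<open>
  Any finite piece of one convex ordering embeds isometrically into any other: level by level, the
  finitely many branches at each node are permuted into the required order.
\<close>

lemma realize_finite_order:
  assumes r: "r \<in> cLO" and t: "t \<in> cLO" and F: "finite F"
  obtains h where "h \<in> carrier iso_baire"
    "\<And>x y. x \<in> F \<Longrightarrow> y \<in> F \<Longrightarrow> (h x, h y) \<in> r \<longleftrightarrow> (x, y) \<in> t"
proof -
  have levelwise: "\<exists>h\<in>carrier iso_baire. \<forall>x\<in>F. \<forall>y\<in>F. trunc n x \<noteq> trunc n y \<longrightarrow>
      ((h x, h y) \<in> r \<longleftrightarrow> (x, y) \<in> t)" for n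
  proof (induction n)
    case 0
    have "id \<in> carrier iso_baire" by (simp add: iso_baire_iff)
    then show ?case by (intro bexI [of _ id]) (simp_all add: trunc_def)
  next
    case (Suc n)
    then obtain h where h: "h \<in> carrier iso_baire"
      and hF: "\<And>x y. x \<in> F \<Longrightarrow> y \<in> F \<Longrightarrow> trunc n x \<noteq> trunc n y \<Longrightarrow>
        (h x, h y) \<in> r \<longleftrightarrow> (x, y) \<in> t" by blast
    have injR: "inj (\<lambda>a. h (s(n := a)))" for s
    proof (rule injI)
      fix a b assume "h (s(n := a)) = h (s(n := b))"
      then have "s(n := a) = s(n := b)" by (rule injD [OF bij_is_inj [OF iso_bij [OF h]]])
      then show "a = b" by (metis fun_upd_same)
    qed
    have injT: "inj (\<lambda>a. s(n := a))" for s :: baire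
      by (rule injI) (metis fun_upd_same)
    have "\<exists>p. bij p \<and> (\<forall>a\<in>(\<lambda>x. x n) ` F. \<forall>b\<in>(\<lambda>x. x n) ` F.
        (h (s(n := p a)), h (s(n := p b))) \<in> r \<longleftrightarrow> (s(n := a), s(n := b)) \<in> t)" for s
      by (rule permutation_between_orders [OF strict_linear_order_inv_image [OF cLO_linear [OF t] injT]
            strict_linear_order_inv_image [OF cLO_linear [OF r] injR], of "(\<lambda>x. x n) ` F" s s])
        (use F in auto)
    then obtain \<alpha> where bij: "\<And>s. bij (\<alpha> s)"
      and \<alpha>: "\<And>s x y. x \<in> F \<Longrightarrow> y \<in> F \<Longrightarrow>
        (h (s(n := \<alpha> s (x n))), h (s(n := \<alpha> s (y n)))) \<in> r \<longleftrightarrow> (s(n := x n), s(n := y n)) \<in> t"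
      by (metis (no_types, lifting) imageI)
    have l: "level n \<alpha> \<in> carrier iso_baire" using bij by (rule level_iso)
    have "((h \<circ> level n \<alpha>) x, (h \<circ> level n \<alpha>) y) \<in> r \<longleftrightarrow> (x, y) \<in> t"
      if xy: "x \<in> F" "y \<in> F" "trunc (Suc n) x \<noteq> trunc (Suc n) y" for x y
    proof (cases "trunc n x = trunc n y")
      case False
      have same: "trunc n (h z) = trunc n (h (level n \<alpha> z))" for z
        using iso_trunc [OF h] by (simp add: trunc_level)
      have "trunc n (h x) \<noteq> trunc n (h y)" using False iso_trunc [OF h] by simp
      then have "(h x, h y) \<in> r \<longleftrightarrow> (h (level n \<alpha> x), h (level n \<alpha> y)) \<in> r"
        by (rule cLO_blocks [OF r same same])
      then show ?thesis using hF [OF xy(1,2) False] by simp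
    next
      case True
      define s where "s = trunc n x"
      have s: "s = trunc n x" "s = trunc n y" using True by (simp_all add: s_def)
      have ne: "x n \<noteq> y n" using xy(3) True by (simp add: trunc_Suc_eq_iff)
      have tr: "trunc (Suc n) (z(n := a)) = trunc (Suc n) (s(n := a))" if "s = trunc n z" for z a
        using that by (simp add: trunc_eq_iff less_Suc_eq) (simp add: trunc_def)
      have lx: "level n \<alpha> x = x(n := \<alpha> s (x n))" "level n \<alpha> y = y(n := \<alpha> s (y n))"
        using s by (simp_all add: level_def)
      have "trunc (Suc n) (h (level n \<alpha> x)) = trunc (Suc n) (h (s(n := \<alpha> s (x n))))"
        "trunc (Suc n) (h (level n \<alpha> y)) = trunc (Suc n) (h (s(n := \<alpha> s (y n))))"
        using tr s iso_trunc [OF h] by (simp_all only: lx)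
      moreover have "trunc (Suc n) (h (level n \<alpha> x)) \<noteq> trunc (Suc n) (h (level n \<alpha> y))"
        using xy(3) iso_trunc [OF h] iso_trunc [OF l] by simp
      ultimately have "(h (level n \<alpha> x), h (level n \<alpha> y)) \<in> r \<longleftrightarrow>
          (h (s(n := \<alpha> s (x n))), h (s(n := \<alpha> s (y n)))) \<in> r"
        by (rule cLO_blocks [OF r])
      also have "\<dots> \<longleftrightarrow> (s(n := x n), s(n := y n)) \<in> t"
        using xy by (intro \<alpha>)
      also have "\<dots> \<longleftrightarrow> (x, y) \<in> t"
      proof (rule sym, rule cLO_blocks [OF t])
        show "trunc (Suc n) x = trunc (Suc n) (s(n := x n))"
          "trunc (Suc n) y = trunc (Suc n) (s(n := y n))"
          using tr [OF s(1), of "x n"] tr [OF s(2), of "y n"] by simp_all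
      qed (rule xy(3))
      finally show ?thesis by simp
    qed
    then show ?case using comp_iso [OF h l] by blast
  qed
  obtain n where n: "\<And>x y. x \<in> F \<Longrightarrow> y \<in> F \<Longrightarrow> x \<noteq> y \<Longrightarrow> trunc n x \<noteq> trunc n y"
    using separating_level [OF F] by blast
  obtain h where h: "h \<in> carrier iso_baire"
    "\<And>x y. x \<in> F \<Longrightarrow> y \<in> F \<Longrightarrow> trunc n x \<noteq> trunc n y \<Longrightarrow> (h x, h y) \<in> r \<longleftrightarrow> (x, y) \<in> t"
    using levelwise [of n] by blast
  have "(h x, h y) \<in> r \<longleftrightarrow> (x, y) \<in> t" if "x \<in> F" "y \<in> F" for x y
  proof (cases "x = y")
    case True
    then show ?thesis
      using strict_linear_orderD(1) [OF cLO_linear [OF r]] strict_linear_orderD(1) [OF cLO_linear [OF t]]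
      by simp
  qed (use h(2) n that in blast)
  then show thesis using that h(1) by blast
qed

lemma dense_orbit_cLO:
  assumes r: "r \<in> cLO"
  shows "cLO_topology closure_of (orbit iso_baire cLO_action r) = topspace cLO_topology"
  unfolding dense_intersects_open
proof (intro allI impI)
  fix U assume U: "openin cLO_topology U \<and> U \<noteq> {}"
  then obtain t where t: "t \<in> U" "t \<in> cLO" using openin_subset by fastforce
  obtain F where F: "finite F" "\<And>s. s \<in> cLO \<Longrightarrow> Restr s F = Restr t F \<Longrightarrow> s \<in> U"
    using cLO_topology_base [OF conjunct1 [OF U] t(1)] by metis
  obtain h where h: "h \<in> carrier iso_baire"
    "\<And>x y. x \<in> F \<Longrightarrow> y \<in> F \<Longrightarrow> (h x, h y) \<in> r \<longleftrightarrow> (x, y) \<in> t"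
    using realize_finite_order [OF r t(2) F(1)] by blast
  let ?g = "inv_into UNIV h"
  have g: "?g \<in> carrier iso_baire" using h(1) by (rule iso_inv_closed)
  have "inv_into UNIV ?g = h" using iso_bij [OF h(1)] by (rule inv_inv_eq)
  then have "(x, y) \<in> cLO_action ?g r \<longleftrightarrow> (x, y) \<in> t" if "x \<in> F" "y \<in> F" for x y
    using h(2) [OF that] by (simp add: cLO_action_iff [OF r])
  then have "Restr (cLO_action ?g r) F = Restr t F" by blast
  then have "cLO_action ?g r \<in> U" by (rule F(2) [OF cLO_action_closed [OF g r]])
  moreover have "cLO_action ?g r \<in> orbit iso_baire cLO_action r"
    using g by (auto simp: orbit_def)
  ultimately show "orbit iso_baire cLO_action r \<inter> U \<noteq> {}" by blast
qed

text \<open>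
  Whether \<open>g\<inverse> x < g\<inverse> y\<close> depends only on the balls that contain \<open>g\<inverse> x\<close> and \<open>g\<inverse> y\<close>, once these
  are disjoint. So a small change of \<open>g\<close> does not matter.
\<close>

lemma continuous_action_cLO:
  "continuous_map (prod_topology iso_baire_topology cLO_topology) cLO_topology
     (\<lambda>(g, r). cLO_action g r)"
proof (rule continuous_map_to_cLO)
  fix p assume "p \<in> topspace (prod_topology iso_baire_topology cLO_topology)"
  then obtain g r where p: "p = (g, r)" "g \<in> carrier iso_baire" "r \<in> cLO" by auto
  then show "(case p of (g, r) \<Rightarrow> cLO_action g r) \<in> cLO" by (simp add: cLO_action_closed)
  fix x y
  let ?u = "inv_into UNIV g x" and ?v = "inv_into UNIV g y"
  obtain n where n: "x \<noteq> y \<Longrightarrow> trunc n x \<noteq> trunc n y"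
    by (rule separating_level [of "{x, y}"]) auto
  let ?U = "iso_nbhd {?u, ?v} n g \<times> {s \<in> cLO. (?u, ?v) \<in> s \<longleftrightarrow> (?u, ?v) \<in> r}"
  have "(x, y) \<in> cLO_action h s \<longleftrightarrow> (x, y) \<in> cLO_action g r"
    if h: "h \<in> iso_nbhd {?u, ?v} n g" and s: "s \<in> cLO" "(?u, ?v) \<in> s \<longleftrightarrow> (?u, ?v) \<in> r" for h s
  proof (cases "x = y")
    case True
    then show ?thesis
      using strict_linear_orderD(1) [OF cLO_linear] s(1) p(3) by (simp add: cLO_action_iff)
  next
    case False
    have "h \<in> carrier iso_baire" using h by (simp add: iso_nbhd_def)
    then have "trunc n (inv_into UNIV h x) \<noteq> trunc n (inv_into UNIV h y)"
      using n [OF False] iso_trunc [OF iso_inv_closed] by blast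
    then have "(inv_into UNIV h x, inv_into UNIV h y) \<in> s \<longleftrightarrow> (?u, ?v) \<in> s"
      using trunc_inv_iso_nbhd [OF h p(2)] by (intro cLO_blocks [OF s(1), of n]) simp_all
    then show ?thesis using s p(3) by (simp add: cLO_action_iff)
  qed
  note loc = this
  show "\<exists>U. openin (prod_topology iso_baire_topology cLO_topology) U \<and> p \<in> U \<and>
      (\<forall>q\<in>U. (x, y) \<in> (case q of (g, r) \<Rightarrow> cLO_action g r) \<longleftrightarrow>
        (x, y) \<in> (case p of (g, r) \<Rightarrow> cLO_action g r))"
  proof (intro exI [of _ ?U] conjI ballI)
    show "openin (prod_topology iso_baire_topology cLO_topology) ?U"
      by (simp add: openin_prod_Times_iff openin_iso_nbhd openin_cLO_pair)
    show "p \<in> ?U" using p by (simp add: iso_nbhd_self)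
    fix q assume "q \<in> ?U"
    then obtain h s where q: "q = (h, s)" "h \<in> iso_nbhd {?u, ?v} n g"
      "s \<in> cLO" "(?u, ?v) \<in> s \<longleftrightarrow> (?u, ?v) \<in> r" by blast
    show "(x, y) \<in> (case q of (g, r) \<Rightarrow> cLO_action g r) \<longleftrightarrow>
        (x, y) \<in> (case p of (g, r) \<Rightarrow> cLO_action g r)"
      using loc [OF q(2-4)] by (simp add: p(1) q(1))
  qed
qed


section \<open>The homogeneous convex ordering\<close>

text \<open>Every node has its successors ordered like the rationals.\<close>

definition lex_order :: "baire rel" where
  "lex_order = {(x, y). \<exists>n. trunc n x = trunc n y \<and> (x n, y n) \<in> rat_less}"

lemma lex_order_iff:
  assumes "trunc n x = trunc n y" "x n \<noteq> y n"
  shows "(x, y) \<in> lex_order \<longleftrightarrow> (x n, y n) \<in> rat_less"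
proof
  assume "(x, y) \<in> lex_order"
  then obtain m where m: "trunc m x = trunc m y" "(x m, y m) \<in> rat_less"
    by (auto simp: lex_order_def)
  have "x m \<noteq> y m" using m(2) strict_linear_orderD(1) [OF strict_linear_order_rat_less] by metis
  then have "m = n" using m(1) assms by (intro first_difference_unique)
  then show "(x n, y n) \<in> rat_less" using m(2) by simp
qed (use assms in \<open>auto simp: lex_order_def\<close>)

lemma lex_order_irrefl: "(x, x) \<notin> lex_order"
  using strict_linear_orderD(1) [OF strict_linear_order_rat_less] by (auto simp: lex_order_def)

lemma lex_order_cLO: "lex_order \<in> cLO"
proof -
  note lin = strict_linear_orderD [OF strict_linear_order_rat_less]
  have conv: "(x, z) \<in> lex_order \<and> (trunc n x = trunc n z \<longrightarrow> trunc n y = trunc n x)"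
    if "(x, y) \<in> lex_order" "(y, z) \<in> lex_order" for x y z n
  proof -
    obtain m where m: "trunc m x = trunc m y" "(x m, y m) \<in> rat_less"
      using \<open>(x, y) \<in> lex_order\<close> by (auto simp: lex_order_def)
    obtain k where k: "trunc k y = trunc k z" "(y k, z k) \<in> rat_less"
      using \<open>(y, z) \<in> lex_order\<close> by (auto simp: lex_order_def)
    define i where "i = min m k"
    have i: "trunc i x = trunc i y" "trunc i y = trunc i z"
      using trunc_eq_mono [OF m(1), of i] trunc_eq_mono [OF k(1), of i] by (simp_all add: i_def)
    have xz: "(x i, z i) \<in> rat_less"
    proof -
      consider "m < k" | "m = k" | "k < m" by linarith
      then show ?thesis
      proof cases
        case 1
        then have "y m = z m" using k(1) by (simp add: trunc_eq_iff)
        then show ?thesis using 1 m(2) by (simp add: i_def)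
      next
        case 2
        then show ?thesis using m(2) k(2) lin(2) by (auto simp: i_def)
      next
        case 3
        then have "x k = y k" using m(1) by (simp add: trunc_eq_iff)
        then show ?thesis using 3 k(2) by (simp add: i_def)
      qed
    qed
    have "trunc n y = trunc n x" if "trunc n x = trunc n z"
    proof -
      have "\<not> i < n"
      proof
        assume "i < n"
        then have "x i = z i" using that by (simp add: trunc_eq_iff)
        then show False using xz lin(1) by simp
      qed
      then show ?thesis using trunc_eq_mono [OF i(1), of n] by simp
    qed
    moreover have "(x, z) \<in> lex_order" using i xz by (auto simp: lex_order_def)
    ultimately show ?thesis by blast
  qed
  have "strict_linear_order lex_order"
    unfolding strict_linear_order_on_def
  proof (intro conjI)
    show "trans lex_order" using conv by (blast intro: transI)
    show "irrefl lex_order" using lex_order_irrefl by (blast intro: irreflI)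
    show "total lex_order"
    proof (rule total_onI)
      fix x y :: baire assume "x \<noteq> y"
      then obtain n where n: "trunc n x = trunc n y" "x n \<noteq> y n" by (rule first_difference)
      then show "(x, y) \<in> lex_order \<or> (y, x) \<in> lex_order"
        using lin(4) [OF n(2)] n(1) [symmetric] unfolding lex_order_def by blast
    qed
  qed
  then show ?thesis unfolding cLO_iff using conv by blast
qed

text \<open>A monotone bijection between linear orderings is an isomorphism.\<close>

lemma lex_order_fixed:
  assumes g: "g \<in> carrier iso_baire"
    and mono: "\<And>x y. (x, y) \<in> lex_order \<Longrightarrow> (g x, g y) \<in> lex_order"
  shows "cLO_action g lex_order = lex_order"
proof -
  note lin = strict_linear_orderD [OF cLO_linear [OF lex_order_cLO]]
  have "(u, v) \<in> cLO_action g lex_order \<longleftrightarrow> (u, v) \<in> lex_order" for u v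
  proof -
    define x y where "x = inv_into UNIV g u" and "y = inv_into UNIV g v"
    have uv: "u = g x" "v = g y" using g by (simp_all add: x_def y_def iso_inv_right)
    have "(x, y) \<in> lex_order \<longleftrightarrow> (g x, g y) \<in> lex_order"
      using mono lin by metis
    then show ?thesis using uv cLO_action_image [OF g lex_order_cLO] by simp
  qed
  then show ?thesis by auto
qed

lemma node_fixes_lex_order:
  assumes p: "p \<in> rat_aut"
  shows "cLO_action (node n s p) lex_order = lex_order"
proof (rule lex_order_fixed)
  show g: "node n s p \<in> carrier iso_baire" using rat_aut_bij [OF p] by (rule node_iso)
  fix x y assume "(x, y) \<in> lex_order"
  then obtain m where m: "trunc m x = trunc m y" "(x m, y m) \<in> rat_less"
    by (auto simp: lex_order_def)
  have "trunc m (node n s p x) = trunc m (node n s p y)"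
    using m(1) iso_trunc [OF g] by blast
  moreover have "(node n s p x m, node n s p y m) \<in> rat_less"
    using m trunc_eq_mono [OF m(1), of n] rat_aut_less [OF p]
    by (cases "m = n") (auto simp: node_apply)
  ultimately show "(node n s p x, node n s p y) \<in> lex_order" by (auto simp: lex_order_def)
qed

interpretation cLO: minimal_flow iso_baire iso_baire_topology cLO_topology cLO_action
proof -
  interpret topological_group iso_baire iso_baire_topology by (rule topological_group_iso_baire)
  interpret group_action iso_baire "topspace cLO_topology" cLO_action
    using group_action_cLO by simp
  show "minimal_flow iso_baire iso_baire_topology cLO_topology cLO_action"
    by unfold_locales
      (use lex_order_cLO compact_cLO Hausdorff_cLO continuous_action_cLO dense_orbit_cLO in auto)
qed

text \<open>
  An isometry that preserves the ordering on a finite set agrees on this set, to any given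
  precision, with a finite product of automorphisms at single nodes: at each level the remaining
  discrepancy is a finite partial automorphism of the rationals at finitely many nodes.
\<close>

lemma lex_order_homogeneous:
  assumes L: "subgroup L iso_baire"
    and nodes: "\<And>n s p. p \<in> rat_aut \<Longrightarrow> node n s p \<in> L"
    and fixed: "\<And>h. h \<in> L \<Longrightarrow> cLO_action h lex_order = lex_order"
    and k: "k \<in> carrier iso_baire" and "finite E"
    and kE: "\<And>x y. x \<in> E \<Longrightarrow> y \<in> E \<Longrightarrow> (x, y) \<in> lex_order \<Longrightarrow> (k x, k y) \<in> lex_order"
  shows "\<exists>h\<in>L. \<forall>x\<in>E. trunc n (h x) = trunc n (k x)"
proof (induction n)
  case 0
  have "id \<in> L" using subgroup.one_closed [OF L] by (metis one_iso_baire)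
  then show ?case by (intro bexI [of _ id]) (simp_all add: trunc_def)
next
  case (Suc n)
  then obtain h where h: "h \<in> L" "\<And>x. x \<in> E \<Longrightarrow> trunc n (h x) = trunc n (k x)" by blast
  have hG: "h \<in> carrier iso_baire" using h(1) subgroup.subset [OF L] by blast
  define h' where "h' = inv_into UNIV h"
  have h': "h' \<in> L" using subgroup.m_inv_closed [OF L h(1)] inv_iso_baire [OF hG]
    by (simp add: h'_def)
  have h'G: "h' \<in> carrier iso_baire" using h' subgroup.subset [OF L] by blast
  have hh': "h (h' x) = x" for x using hG by (simp add: h'_def iso_inv_right)
  \<comment> \<open>The remaining discrepancy, which moves no point of \<open>E\<close> before coordinate \<open>n\<close>.\<close>
  define k' where "k' x = h' (k x)" for x
  have k'n: "trunc n (k' x) = trunc n x" if "x \<in> E" for x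
  proof -
    have "trunc n (h (k' x)) = trunc n (h x)" using h(2) [OF that] by (simp add: k'_def hh')
    then show ?thesis using iso_trunc [OF hG] by blast
  qed
  have k'less: "(k' x, k' y) \<in> lex_order" if "x \<in> E" "y \<in> E" "(x, y) \<in> lex_order" for x y
    using cLO_action_image [OF h'G lex_order_cLO, of "k x" "k y"] kE [OF that]
    by (simp add: k'_def fixed [OF h'])
  have k'tr: "trunc m (k' x) = trunc m (k' y) \<longleftrightarrow> trunc m x = trunc m y" for m x y
    unfolding k'_def using iso_trunc [OF h'G] iso_trunc [OF k] by blast
  define S where "S = trunc n ` E"
  have "\<exists>p. p \<in> rat_aut \<and> (\<forall>x\<in>E. trunc n x = s \<longrightarrow> p (x n) = k' x n)" for s
  proof -
    define X where "X = {x \<in> E. trunc n x = s}"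
    have "finite X" using \<open>finite E\<close> by (simp add: X_def)
    define f where "f a = k' (SOME x. x \<in> X \<and> x n = a) n" for a
    have f: "f (x n) = k' x n" if "x \<in> X" for x
    proof -
      let ?y = "SOME y. y \<in> X \<and> y n = x n"
      have y: "?y \<in> X \<and> ?y n = x n" by (rule someI [of _ x]) (simp add: that)
      then have "trunc (Suc n) ?y = trunc (Suc n) x"
        using that by (simp add: trunc_Suc_eq_iff X_def)
      then have "trunc (Suc n) (k' ?y) = trunc (Suc n) (k' x)" using k'tr by blast
      then show ?thesis by (simp add: f_def trunc_Suc_eq_iff)
    qed
    have "(f a, f b) \<in> rat_less"
      if ab: "a \<in> (\<lambda>x. x n) ` X" "b \<in> (\<lambda>x. x n) ` X" "(a, b) \<in> rat_less" for a b
    proof -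
      obtain x y where xy: "x \<in> X" "y \<in> X" "a = x n" "b = y n" using ab by blast
      have tr: "trunc n x = trunc n y" using xy by (simp add: X_def)
      then have "(x, y) \<in> lex_order" using ab(3) xy by (auto simp: lex_order_def)
      then have less: "(k' x, k' y) \<in> lex_order" using k'less xy by (simp add: X_def)
      have "x n \<noteq> y n"
        using ab(3) xy strict_linear_orderD(1) [OF strict_linear_order_rat_less] by auto
      then have "trunc (Suc n) (k' x) \<noteq> trunc (Suc n) (k' y)"
        using k'tr by (simp add: trunc_Suc_eq_iff)
      moreover have tr': "trunc n (k' x) = trunc n (k' y)" using tr k'tr by blast
      ultimately have "k' x n \<noteq> k' y n" by (simp add: trunc_Suc_eq_iff)
      then show ?thesis using less lex_order_iff [OF tr'] f xy by simp
    qed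
    then obtain p where p: "p \<in> rat_aut" "\<And>a. a \<in> (\<lambda>x. x n) ` X \<Longrightarrow> p a = f a"
      using rat_aut_extend [of "(\<lambda>x. x n) ` X" f] \<open>finite X\<close> by blast
    have "p (x n) = k' x n" if "x \<in> E" "trunc n x = s" for x
      using that p(2) f by (simp add: X_def)
    then show ?thesis using p(1) by blast
  qed
  then obtain \<beta> where \<beta>: "\<And>s. \<beta> s \<in> rat_aut"
    "\<And>s x. x \<in> E \<Longrightarrow> trunc n x = s \<Longrightarrow> \<beta> s (x n) = k' x n" by metis
  define \<alpha> where "\<alpha> s = (if s \<in> S then \<beta> s else id)" for s
  have lev: "level n \<alpha> \<in> L"
    by (rule level_in_subgroup [OF L, of S])
      (use \<open>finite E\<close> \<beta>(1) nodes in \<open>simp_all add: S_def \<alpha>_def\<close>)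
  have "trunc (Suc n) ((h \<circ> level n \<alpha>) x) = trunc (Suc n) (k x)" if "x \<in> E" for x
  proof -
    have "level n \<alpha> x n = k' x n"
      using that \<beta>(2) [OF that refl] by (simp add: level_def \<alpha>_def S_def)
    then have "trunc (Suc n) (level n \<alpha> x) = trunc (Suc n) (k' x)"
      using k'n [OF that] by (simp add: trunc_Suc_eq_iff trunc_level)
    then have "trunc (Suc n) (h (level n \<alpha> x)) = trunc (Suc n) (h (k' x))"
      using iso_trunc [OF hG] by blast
    then show ?thesis by (simp add: k'_def hh')
  qed
  moreover have "h \<circ> level n \<alpha> \<in> L"
    using subgroup.m_closed [OF L h(1) lev] by (simp only: mult_iso_baire)
  ultimately show ?case by blast
qed


section \<open>Fixed points of automorphisms at the nodes\<close>

locale baire_flow = flow iso_baire iso_baire_topology Y \<psi>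
  for Y :: "'y topology" and \<psi>
begin

lemma act_closed: "g \<in> carrier iso_baire \<Longrightarrow> y \<in> topspace Y \<Longrightarrow> \<psi> g y \<in> topspace Y"
  by (rule element_image) simp_all

lemma act_comp:
  assumes "g \<in> carrier iso_baire" "h \<in> carrier iso_baire" "y \<in> topspace Y"
  shows "\<psi> g (\<psi> h y) = \<psi> (g \<circ> h) y"
  using composition_rule [OF assms(3,1,2)] by (simp only: mult_iso_baire)

lemma act_id: "y \<in> topspace Y \<Longrightarrow> \<psi> id y = y"
  using id_eq_one by (metis one_iso_baire restrict_apply')

lemma act_continuous:
  assumes "g \<in> carrier iso_baire"
  shows "continuous_map Y Y (\<psi> g)"
proof -
  have "continuous_map Y (prod_topology iso_baire_topology Y) (\<lambda>y. (g, y))"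
    using assms by (simp add: continuous_map_paired)
  from continuous_map_compose [OF this continuous_action] show ?thesis by (simp add: o_def)
qed

lemma act_near_identity:
  assumes U: "openin Y U" and z: "z \<in> U"
  obtains F n W where "finite F" "openin Y W" "z \<in> W"
    "\<And>g w. g \<in> iso_nbhd F n id \<Longrightarrow> w \<in> W \<Longrightarrow> \<psi> g w \<in> U"
proof -
  let ?N = "{p \<in> topspace (prod_topology iso_baire_topology Y). (\<lambda>(g, y). \<psi> g y) p \<in> U}"
  have zY: "z \<in> topspace Y" using openin_subset [OF U] z by blast
  have id: "id \<in> carrier iso_baire" by (simp add: iso_baire_iff)
  have "openin (prod_topology iso_baire_topology Y) ?N"
    by (rule openin_continuous_map_preimage [OF continuous_action U])
  moreover have "(id, z) \<in> ?N" using z zY id by (simp add: act_id)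
  ultimately obtain V W where V: "openin iso_baire_topology V" "id \<in> V"
    and W: "openin Y W" "z \<in> W" and VW: "V \<times> W \<subseteq> ?N"
    unfolding openin_prod_topology_alt by blast
  obtain F n where F: "finite F" "iso_nbhd F n id \<subseteq> V"
    using iso_nbhd_base [OF V] by blast
  have "\<psi> g w \<in> U" if "g \<in> iso_nbhd F n id" "w \<in> W" for g w
  proof -
    have "(g, w) \<in> ?N" using VW F(2) that by blast
    then show ?thesis by simp
  qed
  then show thesis using that F(1) W by blast
qed

definition node_fixed :: "nat \<Rightarrow> baire \<Rightarrow> 'y set" where
  "node_fixed n s = {y \<in> topspace Y. \<forall>p\<in>rat_aut. \<psi> (node n s p) y = y}"

definition node_invariant :: "nat \<Rightarrow> baire \<Rightarrow> 'y set \<Rightarrow> bool" where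
  "node_invariant n s Z \<longleftrightarrow> (\<forall>p\<in>rat_aut. \<forall>z\<in>Z. \<psi> (node n s p) z \<in> Z)"

lemma node_carrier: "p \<in> rat_aut \<Longrightarrow> node n s p \<in> carrier iso_baire"
  by (simp add: node_iso rat_aut_bij)

lemma closedin_node_fixed: "closedin Y (node_fixed n s)"
proof -
  have "closedin Y {y \<in> topspace Y. \<psi> (node n s p) y = y}" if "p \<in> rat_aut" for p
    using closedin_continuous_maps_eq [OF Hausdorff act_continuous [OF node_carrier [OF that]],
        of "\<lambda>y. y"] by simp
  then have "closedin Y (\<Inter>p\<in>rat_aut. {y \<in> topspace Y. \<psi> (node n s p) y = y})"
    using id_rat_aut by (intro closedin_INT) auto
  moreover have "(\<Inter>p\<in>rat_aut. {y \<in> topspace Y. \<psi> (node n s p) y = y}) = node_fixed n s"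
    using id_rat_aut unfolding node_fixed_def by blast
  ultimately show ?thesis by simp
qed

text \<open>
  The automorphism group of the rationals is extremely amenable. If it had no fixed point in \<open>Z\<close>,
  then \<open>Z\<close> would be covered by finitely many open sets \<open>U z\<close>, each disjoint from its image under
  some automorphism \<open>p z\<close>. Colour an automorphism \<open>q\<close> by a set of this cover that contains
  \<open>q\<inverse> z0\<close>; by continuity and compactness the colour can be chosen to depend only on the
  values of \<open>q\<close> on a finite set. Ramsey's theorem gives an automorphism that keeps its colour when
  composed with each \<open>(p z)\<inverse>\<close>, so some \<open>U z\<close> meets its image under \<open>p z\<close>.
\<close>

lemma node_fixed_point:
  assumes Z: "closedin Y Z" "Z \<noteq> {}" and inv: "node_invariant n s Z"
  shows "Z \<inter> node_fixed n s \<noteq> {}"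
proof
  assume none: "Z \<inter> node_fixed n s = {}"
  have ZY: "Z \<subseteq> topspace Y" using closedin_subset [OF Z(1)] .
  define \<nu> where "\<nu> = node n s"
  have \<nu>: "\<nu> p \<in> carrier iso_baire" if "p \<in> rat_aut" for p
    using that by (simp add: \<nu>_def node_carrier)
  have comp: "\<psi> (\<nu> p) (\<psi> (\<nu> q) z) = \<psi> (\<nu> (p \<circ> q)) z"
    if "p \<in> rat_aut" "q \<in> rat_aut" "z \<in> Z" for p q z
    using act_comp [OF \<nu> [OF that(1)] \<nu> [OF that(2)]] that(3) ZY by (auto simp: \<nu>_def node_comp)
  have invZ: "\<psi> (\<nu> p) z \<in> Z" if "p \<in> rat_aut" "z \<in> Z" for p z
    using inv that by (simp add: node_invariant_def \<nu>_def)
  have "\<exists>p U W C. p \<in> rat_aut \<and> openin Y W \<and> z \<in> W \<and> finite C \<and>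
      (\<forall>w\<in>W. \<forall>q\<in>rat_aut. (\<forall>a\<in>C. q a = a) \<longrightarrow> \<psi> (\<nu> q) w \<in> U) \<and>
      (\<forall>u\<in>U. \<psi> (\<nu> p) u \<notin> U)" if z: "z \<in> Z" for z
  proof -
    have zY: "z \<in> topspace Y" using z ZY by blast
    obtain p where p: "p \<in> rat_aut" "\<psi> (\<nu> p) z \<noteq> z"
      using none z zY by (auto simp: node_fixed_def \<nu>_def)
    have "\<psi> (\<nu> p) z \<in> topspace Y" using act_closed [OF \<nu> [OF p(1)] zY] .
    then obtain U1 U2 where U12: "openin Y U1" "openin Y U2" "z \<in> U1" "\<psi> (\<nu> p) z \<in> U2"
      "disjnt U1 U2"
      using Hausdorff zY p(2) unfolding Hausdorff_space_def by metis
    define U where "U = {y \<in> U1. \<psi> (\<nu> p) y \<in> U2}"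
    have "openin Y U"
      unfolding U_def
      by (rule openin_continuous_map_preimage_gen [OF act_continuous [OF \<nu> [OF p(1)]] U12(1,2)])
    moreover have "z \<in> U" using U12 by (simp add: U_def)
    ultimately obtain F m W where W: "finite F" "openin Y W" "z \<in> W"
      "\<And>g w. g \<in> iso_nbhd F m id \<Longrightarrow> w \<in> W \<Longrightarrow> \<psi> g w \<in> U"
      by (rule act_near_identity) blast
    define C where "C = (\<lambda>x. x n) ` F"
    have "\<nu> q \<in> iso_nbhd F m id" if "q \<in> rat_aut" "\<forall>a\<in>C. q a = a" for q
      using that \<nu> [OF that(1)] by (auto simp: iso_nbhd_def \<nu>_def node_apply C_def)
    then have "\<forall>w\<in>W. \<forall>q\<in>rat_aut. (\<forall>a\<in>C. q a = a) \<longrightarrow> \<psi> (\<nu> q) w \<in> U"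
      using W(4) by blast
    moreover have "\<forall>u\<in>U. \<psi> (\<nu> p) u \<notin> U" using U12(5) by (auto simp: U_def disjnt_iff)
    moreover have "finite C" using W(1) by (simp add: C_def)
    ultimately show ?thesis using p(1) W(2,3) by blast
  qed
  then obtain p U W C where pUWC: "\<And>z. z \<in> Z \<Longrightarrow> p z \<in> rat_aut \<and> openin Y (W z) \<and> z \<in> W z \<and>
      finite (C z) \<and>
      (\<forall>w\<in>W z. \<forall>q\<in>rat_aut. (\<forall>a\<in>C z. q a = a) \<longrightarrow> \<psi> (\<nu> q) w \<in> U z) \<and>
      (\<forall>u\<in>U z. \<psi> (\<nu> (p z)) u \<notin> U z)" by metis
  have p: "p z \<in> rat_aut" and W: "openin Y (W z)" "z \<in> W z" and C: "finite (C z)"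
    and WU: "\<And>w q. w \<in> W z \<Longrightarrow> q \<in> rat_aut \<Longrightarrow> (\<And>a. a \<in> C z \<Longrightarrow> q a = a) \<Longrightarrow> \<psi> (\<nu> q) w \<in> U z"
    and U: "\<And>u. u \<in> U z \<Longrightarrow> \<psi> (\<nu> (p z)) u \<notin> U z"
    if "z \<in> Z" for z
    using pUWC [OF that] by blast+
  have "compactin Y Z" using compact Z(1) by (rule closedin_compact_space)
  moreover have "\<And>V. V \<in> W ` Z \<Longrightarrow> openin Y V" using W(1) by blast
  moreover have "Z \<subseteq> \<Union> (W ` Z)" using W(2) by blast
  ultimately have "\<exists>\<F>. finite \<F> \<and> \<F> \<subseteq> W ` Z \<and> Z \<subseteq> \<Union>\<F>" by (rule compactinD)
  then obtain D where D: "finite D" "D \<subseteq> Z" "Z \<subseteq> \<Union> (W ` D)"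
    by (metis finite_subset_image)
  define B where "B = (\<Union>z\<in>D. C z)"
  have "finite B" unfolding B_def using D C by blast
  obtain z0 where z0: "z0 \<in> Z" using Z(2) by blast
  \<comment> \<open>Quantifying over \<open>v\<close> makes the admissible colours of \<open>q\<close> depend only on its values on \<open>B\<close>.\<close>
  define good where "good q z \<longleftrightarrow> z \<in> D \<and>
      (\<forall>v\<in>rat_aut. (\<forall>a\<in>B. v a = a) \<longrightarrow> \<psi> (\<nu> (v \<circ> inv_into UNIV q)) z0 \<in> U z)" for q z
  have good_ex: "\<exists>z. good q z" if q: "q \<in> rat_aut" for q
  proof -
    have q': "inv_into UNIV q \<in> rat_aut" using q by (rule inv_rat_aut)
    then obtain z where z: "z \<in> D" "\<psi> (\<nu> (inv_into UNIV q)) z0 \<in> W z"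
      using D(3) invZ z0 by blast
    have "\<psi> (\<nu> (v \<circ> inv_into UNIV q)) z0 \<in> U z" if "v \<in> rat_aut" "\<forall>a\<in>B. v a = a" for v
      unfolding comp [OF that(1) q' z0, symmetric]
      using z D(2) that by (intro WU) (auto simp: B_def)
    then show ?thesis using z(1) unfolding good_def by blast
  qed
  have good_mono: "good r z"
    if q: "q \<in> rat_aut" and r: "r \<in> rat_aut" and eq: "\<And>a. a \<in> B \<Longrightarrow> q a = r a" and good: "good q z"
    for q r z
    unfolding good_def
  proof (intro conjI ballI impI)
    show "z \<in> D" using good by (simp add: good_def)
    fix v assume v: "v \<in> rat_aut" "\<forall>a\<in>B. v a = a"
    \<comment> \<open>Chosen so that \<open>w q\<inverse> = v r\<inverse>\<close>; it fixes \<open>B\<close> because \<open>q\<close> and \<open>r\<close> agree there.\<close>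
    define w where "w = v \<circ> inv_into UNIV r \<circ> q"
    have "w \<in> rat_aut" unfolding w_def by (intro comp_rat_aut inv_rat_aut v(1) q r)
    moreover have "\<forall>a\<in>B. w a = a"
      using v(2) eq rat_aut_bij [OF r] by (simp add: w_def bij_is_inj)
    ultimately have "\<psi> (\<nu> (w \<circ> inv_into UNIV q)) z0 \<in> U z" using good by (simp add: good_def)
    moreover have "w \<circ> inv_into UNIV q = v \<circ> inv_into UNIV r"
      using rat_aut_bij [OF q] by (auto simp: w_def fun_eq_iff bij_is_surj surj_f_inv_f)
    ultimately show "\<psi> (\<nu> (v \<circ> inv_into UNIV r)) z0 \<in> U z" by simp
  qed
  define c where "c q = (SOME z. good q z)" for q
  have c: "good q (c q)" if "q \<in> rat_aut" for q
    unfolding c_def using good_ex [OF that] by (rule someI_ex)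
  have "finite (c ` rat_aut)"
    by (rule finite_subset [OF _ D(1)]) (use c in \<open>auto simp: good_def\<close>)
  moreover have "c q = c r" if "q \<in> rat_aut" "r \<in> rat_aut" "\<And>a. a \<in> B \<Longrightarrow> q a = r a" for q r
  proof -
    have "good q = good r" using good_mono that by (intro ext) metis
    then show ?thesis by (simp add: c_def)
  qed
  moreover define K where "K = insert id ((\<lambda>z. inv_into UNIV (p z)) ` D)"
  moreover have "finite K" "K \<subseteq> rat_aut"
    using D p inv_rat_aut id_rat_aut by (auto simp: K_def)
  ultimately obtain g where g: "g \<in> rat_aut"
    "\<And>h h'. h \<in> K \<Longrightarrow> h' \<in> K \<Longrightarrow> c (g \<circ> h) = c (g \<circ> h')"
    using rat_aut_ramsey [OF \<open>finite B\<close>, of K c] by blast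
  define z where "z = c g"
  have z: "z \<in> D" "z \<in> Z" using c [OF g(1)] D(2) by (auto simp: good_def z_def)
  let ?q = "g \<circ> inv_into UNIV (p z)"
  have pz: "p z \<in> rat_aut" using p z by blast
  have q: "?q \<in> rat_aut" by (intro comp_rat_aut g(1) inv_rat_aut pz)
  have "c ?q = z"
    using g(2) [of id "inv_into UNIV (p z)"] z(1) by (simp add: K_def z_def)
  then have "good ?q z" using c [OF q] by simp
  then have "\<psi> (\<nu> (id \<circ> inv_into UNIV ?q)) z0 \<in> U z"
    unfolding good_def using id_rat_aut by (metis id_apply)
  moreover have "inv_into UNIV ?q = p z \<circ> inv_into UNIV g"
    using rat_aut_bij [OF g(1)] rat_aut_bij [OF pz]
    by (simp add: o_inv_distrib bij_imp_bij_inv inv_inv_eq)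
  ultimately have "\<psi> (\<nu> (p z \<circ> inv_into UNIV g)) z0 \<in> U z" by simp
  then have "\<psi> (\<nu> (p z)) (\<psi> (\<nu> (inv_into UNIV g)) z0) \<in> U z"
    using comp [OF pz inv_rat_aut [OF g(1)] z0] by simp
  moreover have "\<psi> (\<nu> (id \<circ> inv_into UNIV g)) z0 \<in> U z"
    using c [OF g(1)] id_rat_aut unfolding good_def z_def by (metis id_apply)
  then have "\<psi> (\<nu> (inv_into UNIV g)) z0 \<in> U z" by simp
  ultimately show False using U [OF z(2)] by blast
qed

text \<open>
  Permutations at different nodes of one level commute, so the points fixed at some nodes form an
  invariant set for the others.
\<close>

lemma finite_nodes_fixed_point:
  assumes Z: "closedin Y Z" "Z \<noteq> {}" and inv: "\<And>s. node_invariant n s Z" and "finite S"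
  shows "Z \<inter> (\<Inter>s\<in>S. node_fixed n s) \<noteq> {}"
  using \<open>finite S\<close>
proof (induction S rule: finite_induct)
  case empty
  then show ?case using Z(2) by simp
next
  case (insert s S)
  let ?Z = "Z \<inter> (\<Inter>t\<in>S. node_fixed n t)"
  have "closedin Y ?Z"
  proof (cases "S = {}")
    case False
    then show ?thesis using Z(1) closedin_node_fixed by (intro closedin_Int closedin_INT)
  qed (use Z(1) in simp)
  moreover have "node_invariant n s ?Z"
    unfolding node_invariant_def
  proof (intro ballI IntI INT_I)
    fix p z assume p: "p \<in> rat_aut" and z: "z \<in> ?Z"
    show "\<psi> (node n s p) z \<in> Z" using inv p z by (simp add: node_invariant_def)
    fix t assume t: "t \<in> S"
    have "s \<noteq> t" using t insert.hyps by blast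
    have zY: "z \<in> topspace Y" using z closedin_subset [OF Z(1)] by blast
    have "\<psi> (node n t q) (\<psi> (node n s p) z) = \<psi> (node n s p) z" if q: "q \<in> rat_aut" for q
    proof -
      have "\<psi> (node n t q) (\<psi> (node n s p) z) = \<psi> (node n s p) (\<psi> (node n t q) z)"
        using act_comp [OF node_carrier [OF q] node_carrier [OF p] zY, of n t n s]
          act_comp [OF node_carrier [OF p] node_carrier [OF q] zY, of n s n t]
          node_commute [OF \<open>s \<noteq> t\<close>] by simp
      also have "\<psi> (node n t q) z = z" using z t q by (simp add: node_fixed_def)
      finally show ?thesis .
    qed
    then show "\<psi> (node n s p) z \<in> node_fixed n t"
      using act_closed [OF node_carrier [OF p] zY] by (simp add: node_fixed_def)
  qed
  ultimately have "?Z \<inter> node_fixed n s \<noteq> {}"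
    using insert.IH by (intro node_fixed_point)
  then show ?case by auto
qed

lemma level_fixed_point:
  assumes Z: "closedin Y Z" "Z \<noteq> {}" and inv: "\<And>s. node_invariant n s Z"
  shows "Z \<inter> (\<Inter>s. node_fixed n s) \<noteq> {}"
proof -
  let ?\<U> = "range (\<lambda>s. Z \<inter> node_fixed n s)"
  have "\<forall>C\<in>?\<U>. closedin Y C" using Z(1) closedin_node_fixed by auto
  moreover have "\<forall>\<F>. finite \<F> \<and> \<F> \<subseteq> ?\<U> \<longrightarrow> \<Inter>\<F> \<noteq> {}"
  proof (intro allI impI)
    fix \<F> assume \<F>: "finite \<F> \<and> \<F> \<subseteq> ?\<U>"
    obtain S where S: "finite S" "\<F> = (\<lambda>s. Z \<inter> node_fixed n s) ` S"
      using finite_subset_image [OF conjunct1 [OF \<F>] conjunct2 [OF \<F>]] by blast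
    then show "\<Inter>\<F> \<noteq> {}" using finite_nodes_fixed_point [OF Z inv S(1)] by auto
  qed
  ultimately have "\<Inter>?\<U> \<noteq> {}"
    by (intro compact [unfolded compact_space_fip, rule_format] conjI)
  then show ?thesis by auto
qed

text \<open>
  The deepest level comes first: its permutations form a normal subgroup of those of all levels up
  to it, so their fixed points are still permuted by the levels above.
\<close>

lemma levels_below_fixed_point:
  assumes "closedin Y Z" "Z \<noteq> {}" "\<And>m s. m < n \<Longrightarrow> node_invariant m s Z"
  shows "Z \<inter> {y \<in> topspace Y. \<forall>m<n. \<forall>s. y \<in> node_fixed m s} \<noteq> {}"
  using assms
proof (induction n arbitrary: Z)
  case 0
  then show ?case using closedin_subset [of Y Z] by auto
next
  case (Suc n)
  let ?Z = "Z \<inter> (\<Inter>s. node_fixed n s)"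
  have "closedin Y ?Z" using Suc.prems(1) closedin_node_fixed by (intro closedin_Int closedin_INT) auto
  moreover have "?Z \<noteq> {}" 
    by (rule level_fixed_point [OF Suc.prems(1,2)]) (rule Suc.prems(3), simp)
  moreover have "node_invariant m s ?Z" if mn: "m < n" for m s
    unfolding node_invariant_def
  proof (intro ballI IntI INT_I)
    fix p z t assume p: "p \<in> rat_aut" and z: "z \<in> ?Z"
    show "\<psi> (node m s p) z \<in> Z" using Suc.prems(3) [of m s] mn p z by (simp add: node_invariant_def)
    have zY: "z \<in> topspace Y" using z closedin_subset [OF Suc.prems(1)] by blast
    obtain u where u: "\<And>q. node n t q \<circ> node m s p = node m s p \<circ> node n u q"
      using node_conjugate [OF rat_aut_bij [OF p] mn, of t s] by blast
    have "\<psi> (node n t q) (\<psi> (node m s p) z) = \<psi> (node m s p) z" if q: "q \<in> rat_aut" for q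
    proof -
      have "\<psi> (node n t q) (\<psi> (node m s p) z) = \<psi> (node m s p) (\<psi> (node n u q) z)"
        using act_comp [OF node_carrier [OF q] node_carrier [OF p] zY, of n t m s]
          act_comp [OF node_carrier [OF p] node_carrier [OF q] zY, of m s n u] u by simp
      also have "\<psi> (node n u q) z = z" using z q by (auto simp: node_fixed_def)
      finally show ?thesis .
    qed
    then show "\<psi> (node m s p) z \<in> node_fixed n t"
      using act_closed [OF node_carrier [OF p] zY] by (simp add: node_fixed_def)
  qed
  ultimately have "?Z \<inter> {y \<in> topspace Y. \<forall>m<n. \<forall>s. y \<in> node_fixed m s} \<noteq> {}"
    by (intro Suc.IH)
  then show ?case by (auto simp: less_Suc_eq)
qed

lemma nodes_fixed_point:
  obtains y where "y \<in> topspace Y" "\<And>n s p. p \<in> rat_aut \<Longrightarrow> \<psi> (node n s p) y = y"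
proof -
  define Z where "Z n = {y \<in> topspace Y. \<forall>m<n. \<forall>s. y \<in> node_fixed m s}" for n
  have "closedin Y (Z n)" for n
  proof -
    have "Z n = topspace Y \<inter> (\<Inter>(m, s)\<in>{..<n} \<times> UNIV. node_fixed m s)"
      by (auto simp: Z_def)
    moreover have "closedin Y (topspace Y \<inter> (\<Inter>(m, s)\<in>{..<n} \<times> UNIV. node_fixed m s))"
    proof (cases "n = 0")
      case False
      then show ?thesis
        by (intro closedin_Int closedin_INT) (auto simp: closedin_node_fixed lessThan_empty_iff)
    qed simp
    ultimately show ?thesis by simp
  qed
  moreover have "Z n \<noteq> {}" for n
    using levels_below_fixed_point [of "topspace Y" n] nonempty act_closed node_carrier
    by (auto simp: Z_def node_invariant_def)
  moreover have "decseq Z" by (auto simp: decseq_def Z_def)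
  ultimately have "(\<Inter>n. Z n) \<noteq> {}" using compact by (intro compact_space_imp_nest)
  then obtain y where y: "y \<in> Z n" for n by blast
  have "\<psi> (node n s p) y = y" if "p \<in> rat_aut" for n s p
    using y [of "Suc n"] that by (simp add: Z_def node_fixed_def)
  moreover have "y \<in> topspace Y" using y [of 0] by (simp add: Z_def)
  ultimately show thesis using that by blast
qed

end


section \<open>The homomorphism onto a minimal flow\<close>

context baire_flow
begin

definition graph_closure :: "'y \<Rightarrow> (baire rel \<times> 'y) set" where
  "graph_closure y = prod_topology cLO_topology Y closure_of
     {(cLO_action g lex_order, \<psi> g y) | g. g \<in> carrier iso_baire}"

text \<open>
  Since \<open>g \<cdot> lex_order\<close> and \<open>h \<cdot> lex_order\<close> agree on \<open>F\<close>, the isometry \<open>h\<inverse> g\<close> preserves the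
  ordering on \<open>g\<inverse> F\<close>. By homogeneity it is close there to some \<open>k\<close> that fixes \<open>y\<close>, and
  \<open>h k g\<inverse>\<close> is the required isometry.
\<close>

lemma near_identity_between:
  assumes y: "y \<in> topspace Y" "\<And>n s p. p \<in> rat_aut \<Longrightarrow> \<psi> (node n s p) y = y"
    and "finite F" and g: "g \<in> carrier iso_baire" and h: "h \<in> carrier iso_baire"
    and agree: "Restr (cLO_action g lex_order) F = Restr (cLO_action h lex_order) F"
  obtains v where "v \<in> iso_nbhd F n id" "\<psi> v (\<psi> g y) = \<psi> h y"
proof -
  let ?g' = "inv_into UNIV g" and ?h' = "inv_into UNIV h"
  have g': "?g' \<in> carrier iso_baire" and h': "?h' \<in> carrier iso_baire"
    using g h by (simp_all add: iso_inv_closed)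
  define L where "L = stabilizer iso_baire \<psi> y \<inter> stabilizer iso_baire cLO_action lex_order"
  have L: "subgroup L iso_baire"
    unfolding L_def
    by (intro group.subgroups_Inter_pair group_iso_baire stabilizer_subgroup cLO.stabilizer_subgroup)
      (simp_all add: y lex_order_cLO)
  have Lfix: "\<psi> k y = y" "cLO_action k lex_order = lex_order" "k \<in> carrier iso_baire"
    if "k \<in> L" for k
    using that by (simp_all add: L_def stabilizer_def)
  have "\<exists>k\<in>L. \<forall>x\<in>?g' ` F. trunc n (k x) = trunc n ((?h' \<circ> g) x)"
  proof (rule lex_order_homogeneous [OF L])
    show "node n s p \<in> L" if "p \<in> rat_aut" for n s p
      using that y(2) node_carrier node_fixes_lex_order by (simp add: L_def stabilizer_def)
    show "cLO_action k lex_order = lex_order" if "k \<in> L" for k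
      using Lfix(2) [OF that] .
    show "?h' \<circ> g \<in> carrier iso_baire" using h' g by (rule comp_iso)
    show "finite (?g' ` F)" using \<open>finite F\<close> by simp
    fix x z assume "x \<in> ?g' ` F" "z \<in> ?g' ` F" and xz: "(x, z) \<in> lex_order"
    then obtain a b where ab: "a \<in> F" "b \<in> F" "x = ?g' a" "z = ?g' b" by blast
    have "(a, b) \<in> Restr (cLO_action g lex_order) F"
      using ab xz by (simp add: cLO_action_iff lex_order_cLO)
    then have "(a, b) \<in> cLO_action h lex_order" unfolding agree by blast
    then have "(?h' a, ?h' b) \<in> lex_order" by (simp add: cLO_action_iff lex_order_cLO)
    then show "((?h' \<circ> g) x, (?h' \<circ> g) z) \<in> lex_order"
      using ab g by (simp add: iso_inv_right)
  qed
  then obtain k where k: "k \<in> L" "\<And>a. a \<in> F \<Longrightarrow> trunc n (k (?g' a)) = trunc n (?h' (g (?g' a)))"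
    by auto
  have kG: "k \<in> carrier iso_baire" using Lfix(3) [OF k(1)] .
  define v where "v = h \<circ> k \<circ> ?g'"
  have v: "v \<in> carrier iso_baire" unfolding v_def by (intro comp_iso h kG g')
  have "trunc n (v a) = trunc n (id a)" if "a \<in> F" for a
  proof -
    have "trunc n (k (?g' a)) = trunc n (?h' a)" using k(2) [OF that] g by (simp add: iso_inv_right)
    then have "trunc n (h (k (?g' a))) = trunc n (h (?h' a))" using iso_trunc [OF h] by blast
    then show ?thesis using h by (simp add: v_def iso_inv_right)
  qed
  then have "v \<in> iso_nbhd F n id" using v by (simp add: iso_nbhd_def)
  moreover have "\<psi> v (\<psi> g y) = \<psi> h y"
  proof -
    have "v \<circ> g = h \<circ> k" using g by (auto simp: v_def iso_inv_left)
    then have "\<psi> v (\<psi> g y) = \<psi> (h \<circ> k) y" using act_comp [OF v g y(1)] by simp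
    also have "\<dots> = \<psi> h y" using act_comp [OF h kG y(1)] Lfix(1) [OF k(1)] by simp
    finally show ?thesis .
  qed
  ultimately show thesis by (rule that)
qed

text \<open>
  Orderings \<open>g \<cdot> lex_order\<close> and \<open>h \<cdot> lex_order\<close> close to \<open>r\<close> agree on a large finite set, so an
  isometry close to the identity takes \<open>g \<cdot> y\<close> to \<open>h \<cdot> y\<close>. Hence these points cannot lie near
  different limits.
\<close>

lemma graph_closure_functional:
  assumes y: "y \<in> topspace Y" "\<And>n s p. p \<in> rat_aut \<Longrightarrow> \<psi> (node n s p) y = y"
    and u: "(r, u) \<in> graph_closure y" and w: "(r, w) \<in> graph_closure y"
  shows "u = w"
proof (rule ccontr)
  assume "u \<noteq> w"
  have top: "r \<in> cLO" "u \<in> topspace Y" "w \<in> topspace Y"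
    using u w unfolding graph_closure_def in_closure_of by auto
  obtain A B where AB: "openin Y A" "openin Y B" "u \<in> A" "w \<in> B" "disjnt A B"
    using Hausdorff top \<open>u \<noteq> w\<close> unfolding Hausdorff_space_def by metis
  obtain F n W where W: "finite F" "openin Y W" "u \<in> W"
    "\<And>v x. v \<in> iso_nbhd F n id \<Longrightarrow> x \<in> W \<Longrightarrow> \<psi> v x \<in> A"
    by (rule act_near_identity [OF AB(1,3)]) (rule that)
  define N where "N = {s \<in> cLO. Restr s F = Restr r F}"
  have "openin cLO_topology N"
    unfolding cLO_topology_def
  proof (rule topology_generated_by_Basis, intro CollectI exI conjI)
    show "N = {s \<in> cLO. Restr s F = Restr r F}" by (rule N_def)
  qed (rule W(1), rule top(1))
  moreover have "r \<in> N" unfolding N_def using top(1) by (intro CollectI conjI refl)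
  ultimately have N: "openin cLO_topology N" "r \<in> N" .
  have meet: "\<exists>g\<in>carrier iso_baire. cLO_action g lex_order \<in> N \<and> \<psi> g y \<in> V"
    if "(r, x) \<in> graph_closure y" "openin Y V" "x \<in> V" for x V
  proof -
    have "openin (prod_topology cLO_topology Y) (N \<times> V)" "(r, x) \<in> N \<times> V"
      using N that by (simp_all add: openin_prod_Times_iff)
    moreover have "\<forall>T. (r, x) \<in> T \<and> openin (prod_topology cLO_topology Y) T \<longrightarrow>
        (\<exists>p. p \<in> {(cLO_action g lex_order, \<psi> g y) | g. g \<in> carrier iso_baire} \<and> p \<in> T)"
      using that(1) unfolding graph_closure_def in_closure_of by (rule conjunct2)
    ultimately obtain p where
      "p \<in> {(cLO_action g lex_order, \<psi> g y) | g. g \<in> carrier iso_baire}" "p \<in> N \<times> V"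
      by meson
    then show ?thesis by blast
  qed
  obtain g where g: "g \<in> carrier iso_baire" "cLO_action g lex_order \<in> N" "\<psi> g y \<in> W"
    using meet [OF u W(2,3)] by blast
  obtain h where h: "h \<in> carrier iso_baire" "cLO_action h lex_order \<in> N" "\<psi> h y \<in> B"
    using meet [OF w AB(2,4)] by blast
  have "Restr (cLO_action g lex_order) F = Restr (cLO_action h lex_order) F"
    using g(2) h(2) unfolding N_def by (metis (lifting) mem_Collect_eq)
  then obtain v where v: "v \<in> iso_nbhd F n id" "\<psi> v (\<psi> g y) = \<psi> h y"
    using near_identity_between [OF y W(1) g(1) h(1), of n] by blast
  have "\<psi> h y \<in> A" using W(4) [OF v(1) g(3)] v(2) by simp
  then show False using h(3) AB(5) by (auto simp: disjnt_iff)
qed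

text \<open>The projection of the closure is closed, as \<open>Y\<close> is compact, and contains a dense orbit.\<close>

lemma graph_closure_total:
  assumes y: "y \<in> topspace Y" and r: "r \<in> cLO"
  obtains u where "(r, u) \<in> graph_closure y"
proof -
  have "closedin cLO_topology (fst ` graph_closure y)"
    using Abstract_Topological_Spaces.closed_map_fst [OF compact, of cLO_topology]
    by (simp add: closed_map_def graph_closure_def)
  moreover have "orbit iso_baire cLO_action lex_order \<subseteq> fst ` graph_closure y"
  proof
    fix s assume "s \<in> orbit iso_baire cLO_action lex_order"
    then obtain g where g: "g \<in> carrier iso_baire" "s = cLO_action g lex_order"
      by (auto simp: orbit_def)
    have "(s, \<psi> g y) \<in> graph_closure y"
      unfolding graph_closure_def
      by (rule subsetD [OF closure_of_subset])
        (use g y act_closed cLO_action_closed lex_order_cLO in auto)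
    then show "s \<in> fst ` graph_closure y" by (rule image_eqI [rotated]) simp
  qed
  ultimately have "cLO_topology closure_of orbit iso_baire cLO_action lex_order
      \<subseteq> fst ` graph_closure y"
    by (intro closure_of_minimal)
  then show thesis using dense_orbit_cLO [OF lex_order_cLO] r that by auto
qed

lemma graph_closure_invariant:
  assumes y: "y \<in> topspace Y" and g: "g \<in> carrier iso_baire" and ru: "(r, u) \<in> graph_closure y"
  shows "(cLO_action g r, \<psi> g u) \<in> graph_closure y"
proof -
  interpret c: baire_flow cLO_topology cLO_action ..
  let ?f = "\<lambda>p. (cLO_action g (fst p), \<psi> g (snd p))"
  let ?O = "{(cLO_action g lex_order, \<psi> g y) | g. g \<in> carrier iso_baire}"
  have "continuous_map (prod_topology cLO_topology Y) (prod_topology cLO_topology Y) ?f"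
    unfolding continuous_map_paired
    using continuous_map_compose [OF continuous_map_fst c.act_continuous [OF g]]
      continuous_map_compose [OF continuous_map_snd act_continuous [OF g]]
    unfolding o_def by blast
  then have "?f ` graph_closure y \<subseteq> prod_topology cLO_topology Y closure_of (?f ` ?O)"
    unfolding graph_closure_def by (rule continuous_map_image_closure_subset)
  moreover have "?f ` ?O \<subseteq> ?O"
  proof
    fix q assume "q \<in> ?f ` ?O"
    then obtain h where h: "h \<in> carrier iso_baire"
      "q = (cLO_action g (cLO_action h lex_order), \<psi> g (\<psi> h y))" by auto
    then have "q = (cLO_action (g \<circ> h) lex_order, \<psi> (g \<circ> h) y)"
      using g y act_comp by (simp add: cLO_action_comp lex_order_cLO)
    then show "q \<in> ?O" using comp_iso [OF g h(1)] by blast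
  qed
  then have "prod_topology cLO_topology Y closure_of (?f ` ?O) \<subseteq> graph_closure y"
    unfolding graph_closure_def by (rule closure_of_mono)
  ultimately have "?f ` graph_closure y \<subseteq> graph_closure y" by blast
  then show ?thesis using ru by force
qed

lemma flow_hom_from_cLO:
  obtains f where "flow_hom iso_baire cLO_topology cLO_action Y \<psi> f"
    "closedin Y (f ` cLO)" "\<exists>y\<in>topspace Y. orbit iso_baire \<psi> y \<subseteq> f ` cLO"
proof -
  obtain y where y: "y \<in> topspace Y" "\<And>n s p. p \<in> rat_aut \<Longrightarrow> \<psi> (node n s p) y = y"
    using nodes_fixed_point by blast
  let ?M = "graph_closure y"
  have M: "closedin (prod_topology cLO_topology Y) ?M" by (simp add: graph_closure_def)
  then have Msub: "?M \<subseteq> cLO \<times> topspace Y" using closedin_subset by fastforce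
  define f where "f r = (SOME u. (r, u) \<in> ?M)" for r
  have "(r, f r) \<in> ?M" if "r \<in> cLO" for r
    unfolding f_def using graph_closure_total [OF y(1) that] by (metis someI_ex)
  then have f: "(r, u) \<in> ?M \<longleftrightarrow> r \<in> cLO \<and> u = f r" for r u
    using graph_closure_functional [OF y] Msub by blast
  have fY: "f r \<in> topspace Y" if "r \<in> cLO" for r using f [of r "f r"] Msub that by blast
  have "continuous_map cLO_topology Y f"
    unfolding continuous_map_closedin
  proof (intro conjI allI impI)
    show "f \<in> topspace cLO_topology \<rightarrow> topspace Y" using fY by simp
    fix C assume C: "closedin Y C"
    have "closedin (prod_topology cLO_topology Y) (topspace cLO_topology \<times> C)"
      using C by (subst closedin_prod_Times_iff) blast
    then have "closedin (prod_topology cLO_topology Y) (?M \<inter> (topspace cLO_topology \<times> C))"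
      using M by (intro closedin_Int)
    then have "closedin cLO_topology (fst ` (?M \<inter> (topspace cLO_topology \<times> C)))"
      using Abstract_Topological_Spaces.closed_map_fst [OF compact, of cLO_topology]
      by (simp add: closed_map_def)
    moreover have "fst ` (?M \<inter> (topspace cLO_topology \<times> C)) = {r \<in> topspace cLO_topology. f r \<in> C}"
      using f by (force simp: image_iff)
    ultimately show "closedin cLO_topology {r \<in> topspace cLO_topology. f r \<in> C}" by simp
  qed
  moreover have "f (cLO_action g r) = \<psi> g (f r)" if "g \<in> carrier iso_baire" "r \<in> cLO" for g r
    using graph_closure_invariant [OF y(1) that(1), of r "f r"] f that(2) by auto
  ultimately have "flow_hom iso_baire cLO_topology cLO_action Y \<psi> f"
    by (simp add: flow_hom_def)
  moreover have "closedin Y (f ` cLO)"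
  proof -
    have "closedin Y (snd ` ?M)"
      using Abstract_Topological_Spaces.closed_map_snd [OF compact_cLO, of Y] M
      by (simp add: closed_map_def)
    moreover have "snd ` ?M = f ` cLO" using f by (force simp: image_iff)
    ultimately show ?thesis by simp
  qed
  moreover have "orbit iso_baire \<psi> (f lex_order) \<subseteq> f ` cLO"
  proof
    fix u assume "u \<in> orbit iso_baire \<psi> (f lex_order)"
    then obtain g where g: "g \<in> carrier iso_baire" "u = \<psi> g (f lex_order)"
      by (auto simp: orbit_def)
    then have "u = f (cLO_action g lex_order)"
      using \<open>\<And>r g. \<lbrakk>g \<in> carrier iso_baire; r \<in> cLO\<rbrakk> \<Longrightarrow> f (cLO_action g r) = \<psi> g (f r)\<close>
        lex_order_cLO by simp
    then show "u \<in> f ` cLO" using cLO_action_closed [OF g(1) lex_order_cLO] by blast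
  qed
  ultimately show thesis using that fY [OF lex_order_cLO] by blast
qed

end

theorem theorem41:
  shows "universal_minimal_flow TYPE('y) iso_baire iso_baire_topology cLO_topology cLO_action"
  unfolding universal_minimal_flow_def
proof (intro conjI allI impI)
  show "minimal_flow iso_baire iso_baire_topology cLO_topology cLO_action"
    by (rule cLO.minimal_flow_axioms)
next
  fix Y :: "'y topology" and \<psi>
  assume "minimal_flow iso_baire iso_baire_topology Y \<psi>"
  then interpret Y: minimal_flow iso_baire iso_baire_topology Y \<psi> .
  interpret Y: baire_flow Y \<psi> ..
  obtain f y where f: "flow_hom iso_baire cLO_topology cLO_action Y \<psi> f"
    and closed: "closedin Y (f ` cLO)"
    and y: "y \<in> topspace Y" "orbit iso_baire \<psi> y \<subseteq> f ` cLO"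
    using Y.flow_hom_from_cLO by metis
  have "topspace Y \<subseteq> f ` cLO"
    using closure_of_minimal [OF y(2) closed] Y.dense_orbit [OF y(1)] by simp
  then have "f ` topspace cLO_topology = topspace Y"
    using closedin_subset [OF closed] by auto
  then show "\<exists>f. flow_hom iso_baire cLO_topology cLO_action Y \<psi> f \<and>
      f ` topspace cLO_topology = topspace Y"
    using f by blast
qed

end
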